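(* Let $m\ge n\ge1$, $\mathfrak g=\mathfrak{sl}(m+1|n)$ with the data below, and let $\Lambda\in\hat{\mathfrak h}^*$ have level $k\neq0$ and satisfy $(\Lambda|\beta_i)=0$ for $i=1,\dots,n$. Then $L(\Lambda)$ is integrable if and only if $\Lambda=k\Lambda_0+\sum_{i=1}^nk_i\beta_i+\sum_{i=n+1}^mk_i\epsilon_i+c\delta$ for some $c\in\mathbb{C}$ and integers $k_1,\dots,k_m$ such that $k\in\mathbb{Z}_{>0}$, $k_i\in\mathbb{Z}_{\ge0}$ for all $i$, and $k\ge k_1\ge k_2\ge\dots\ge k_m$.
   Context: Affine setting: $\mathfrak g$ is a basic Lie superalgebra with nondegenerate invariant supersymmetric form $(\cdot|\cdot)$ and Cartan subalgebra $\mathfrak h\subset\mathfrak g_{\bar0}$, identified with $\mathfrak h^*$. $\hat{\mathfrak g}=\mathfrak g[t,t^{-1}]\oplus\mathbb{C}K\oplus\mathbb{C}d$ with $[at^r,bt^s]=[a,b]t^{r+s}+r\delta_{r,-s}(a|b)K$, $K$ central, $[d,at^r]=rat^r$; $\hat{\mathfrak h}=\mathfrak h\oplus\mathbb{C}K\oplus\mathbb{C}d$ with form extended by $(\mathfrak h|\mathbb{C}K+\mathbb{C}d)=0$, $(K|K)=(d|d)=0$, $(K|d)=1$, and $\delta,\Lambda_0\in\hat{\mathfrak h}^*$ correspond to $K,d$. Given simple roots $\Pi$ of $\mathfrak g$ with highest root $\theta$, the positive roots of $\hat{\mathfrak g}$ are the positive roots of $\mathfrak g$ and all $\alpha+r\delta$,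 $\alpha$ a root or $0$, $r>0$; the simple roots are $\{\alpha_0=\delta-\theta\}\cup\Pi$. $L(\Lambda)$ is the irreducible highest weight module with highest weight $\Lambda$ (even highest weight vector) and level $\Lambda(K)$. For a positive root $\gamma$, $L(\Lambda)$ is $\gamma$-integrable if $\hat{\mathfrak g}_{-\gamma}$ acts locally nilpotently; given a distinguished subalgebra $\mathfrak g^\#_{\bar0}\subset\mathfrak g_{\bar0}$ with root set $\Delta^\#_{\bar0}$, $L(\Lambda)$ is integrable if it is $\gamma$-integrable for all positive $\gamma\in\Delta^\#_{\bar0}$ and all $\gamma=\alpha+r\delta$ with $\alpha\in\Delta^\#_{\bar0}$, $r\in\mathbb{Z}_{>0}$. Data: $\mathfrak h$ = supertraceless diagonal matrices, $(a|b)=\operatorname{str}(ab)$; $\epsilon_1,\dots,\epsilon_{m+1},\delta_1,\dots,\delta_n$ are the coordinate functionals on diagonal matrices (restricted to $\mathfrak h$), with $(\epsilon_i|\epsilon_j)=\delta_{ij}$, $(\delta_i|\delta_j)=-\delta_{ij}$, $(\epsilon_i|\delta_j)=0$. Even roots $\epsilon_i-\epsilon_j$, $\delta_i-\delta_j$; odd roots $\pm(\epsilon_i-\delta_j)$. $\mathfrak g^\#_{\bar0}\cong\mathfrak{sl}(m+1)$ with roots $\epsilon_i-\epsilon_j$. Simple roots: $\alpha_{2i-1}=\epsilon_i-\delta_i$, $\alpha_{2i}=\delta_i-\epsilon_{i+1}$ ($1\le i\le n$), $\alpha_i=\epsilon_{i-n}-\epsilon_{i-n+1}$ ($2n+1\le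 i\le m+n$); $\theta=\epsilon_1-\epsilon_{m+1}$. $\beta_i=\epsilon_i-\delta_i$, $i=1,\dots,n$. *)

theory Defs
  imports Main "HOL-Analysis.Analysis"
begin

text \<open>Concrete model of the affine Lie superalgebra of sl(m+1|n).
 Coordinates of (m+1+n)x(m+1+n) matrices: index i-1 (i = 1..m+1) is epsilon_i,
 index m+j (j = 1..n) is delta_j. Matrices are functions nat => nat => complex
 vanishing outside the square of size m+1+n.\<close>

type_synonym cmat = "nat \<Rightarrow> nat \<Rightarrow> complex"

definition dimN :: "nat \<Rightarrow> nat \<Rightarrow> nat" where "dimN m n = m + 1 + n"

definition odd_idx :: "nat \<Rightarrow> nat \<Rightarrow> bool" where "odd_idx m i = (m < i)"

definition is_mat :: "nat \<Rightarrow> nat \<Rightarrow> cmat \<Rightarrow> bool" where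
  "is_mat m n a = (\<forall>i j. (dimN m n \<le> i \<or> dimN m n \<le> j) \<longrightarrow> a i j = 0)"

definition str :: "nat \<Rightarrow> nat \<Rightarrow> cmat \<Rightarrow> complex" where
  "str m n a = (\<Sum>i<m+1. a i i) - (\<Sum>i\<in>{m+1..<dimN m n}. a i i)"

definition slmat :: "nat \<Rightarrow> nat \<Rightarrow> cmat \<Rightarrow> bool" where
  "slmat m n a = (is_mat m n a \<and> str m n a = 0)"

definition homog :: "nat \<Rightarrow> bool \<Rightarrow> cmat \<Rightarrow> bool" where
  "homog m p a = (\<forall>i j. (odd_idx m i \<noteq> odd_idx m j) \<noteq> p \<longrightarrow> a i j = 0)"

definition matmul :: "nat \<Rightarrow> nat \<Rightarrow> cmat \<Rightarrow> cmat \<Rightarrow> cmat" where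
  "matmul m n a b = (\<lambda>i j. \<Sum>k<dimN m n. a i k * b k j)"

definition sbr :: "nat \<Rightarrow> nat \<Rightarrow> bool \<Rightarrow> bool \<Rightarrow> cmat \<Rightarrow> cmat \<Rightarrow> cmat" where
  "sbr m n pa pb a b = (\<lambda>i j. matmul m n a b i j
      - (if pa \<and> pb then -1 else 1) * matmul m n b a i j)"

definition Emat :: "nat \<Rightarrow> nat \<Rightarrow> cmat" where
  "Emat i j = (\<lambda>a b. if a = i \<and> b = j then 1 else 0)"

definition diagmat :: "(nat \<Rightarrow> complex) \<Rightarrow> cmat" where
  "diagmat h = (\<lambda>i j. if i = j then h i else 0)"

text \<open>Elements of the Cartan subalgebra h (supertraceless diagonal matrices),
 given by their diagonal.\<close>
definition sldiag :: "nat \<Rightarrow> nat \<Rightarrow> (nat \<Rightarrow> complex) \<Rightarrow> bool" where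
  "sldiag m n h = slmat m n (diagmat h)"

text \<open>Position of a coordinate in the ordering eps_1, delta_1, ..., eps_n, delta_n,
 eps_(n+1), ..., eps_(m+1) determined by the given simple roots; the positive roots of g
 are e_a - e_b with pos a < pos b.\<close>
definition pos :: "nat \<Rightarrow> nat \<Rightarrow> nat \<Rightarrow> nat" where
  "pos m n i = (if i \<le> m then (if i < n then 2 * i else n + i) else 2 * (i - m) - 1)"

definition upper :: "nat \<Rightarrow> nat \<Rightarrow> cmat \<Rightarrow> bool" where
  "upper m n a = (\<forall>i j. a i j \<noteq> 0 \<longrightarrow> pos m n i < pos m n j)"

text \<open>Invariant form on h^*: (mu|nu) = mu(h_nu), where h_nu in h represents nu
 via (h_nu|h') = str(h_nu h') = nu(h').\<close>
definition hdual :: "nat \<Rightarrow> nat \<Rightarrow> ((nat \<Rightarrow> complex) \<Rightarrow> complex) \<Rightarrow> (nat \<Rightarrow> complex)" where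
  "hdual m n \<nu> = (THE h. sldiag m n h \<and>
      (\<forall>h'. sldiag m n h' \<longrightarrow> str m n (matmul m n (diagmat h) (diagmat h')) = \<nu> h'))"

definition hform :: "nat \<Rightarrow> nat \<Rightarrow> ((nat \<Rightarrow> complex) \<Rightarrow> complex)
    \<Rightarrow> ((nat \<Rightarrow> complex) \<Rightarrow> complex) \<Rightarrow> complex" where
  "hform m n \<mu> \<nu> = \<mu> (hdual m n \<nu>)"

definition eps :: "nat \<Rightarrow> (nat \<Rightarrow> complex) \<Rightarrow> complex" where
  "eps i = (\<lambda>h. h (i - 1))"

definition dlt :: "nat \<Rightarrow> nat \<Rightarrow> (nat \<Rightarrow> complex) \<Rightarrow> complex" where
  "dlt m j = (\<lambda>h. h (m + j))"

definition beta :: "nat \<Rightarrow> nat \<Rightarrow> (nat \<Rightarrow> complex) \<Rightarrow> complex" where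
  "beta m i = (\<lambda>h. eps i h - dlt m i h)"

text \<open>A representation of the affine superalgebra on a complex vector space
 (type 'v with scalar multiplication smul): X r a is the action of a t^r,
 K the action of the central element, D the action of d.\<close>
definition affine_rep :: "nat \<Rightarrow> nat \<Rightarrow> (complex \<Rightarrow> 'v::ab_group_add \<Rightarrow> 'v)
   \<Rightarrow> (int \<Rightarrow> cmat \<Rightarrow> 'v \<Rightarrow> 'v) \<Rightarrow> ('v \<Rightarrow> 'v) \<Rightarrow> ('v \<Rightarrow> 'v) \<Rightarrow> bool" where
  "affine_rep m n smul X K D =
    (Vector_Spaces.vector_space smul \<and>
     (\<forall>r a. slmat m n a \<longrightarrow> Vector_Spaces.linear smul smul (X r a)) \<and>
     Vector_Spaces.linear smul smul K \<and> Vector_Spaces.linear smul smul D \<and>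
     (\<forall>r a b c v. slmat m n a \<and> slmat m n b \<longrightarrow>
        X r (\<lambda>i j. c * a i j + b i j) v = smul c (X r a v) + X r b v) \<and>
     (\<forall>r s a b pa pb v. slmat m n a \<and> slmat m n b \<and> homog m pa a \<and> homog m pb b \<longrightarrow>
        X r a (X s b v) - smul (if pa \<and> pb then -1 else 1) (X s b (X r a v))
          = X (r + s) (sbr m n pa pb a b) v
            + smul (if r + s = 0 then of_int r * str m n (matmul m n a b) else 0) (K v)) \<and>
     (\<forall>r a v. slmat m n a \<longrightarrow> K (X r a v) = X r a (K v)) \<and>
     (\<forall>r a v. slmat m n a \<longrightarrow> D (X r a v) - X r a (D v) = smul (of_int r) (X r a v)) \<and>
     (\<forall>v. K (D v) = D (K v)))"

definition submodule :: "nat \<Rightarrow> nat \<Rightarrow> (complex \<Rightarrow> 'v::ab_group_add \<Rightarrow> 'v)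
   \<Rightarrow> (int \<Rightarrow> cmat \<Rightarrow> 'v \<Rightarrow> 'v) \<Rightarrow> ('v \<Rightarrow> 'v) \<Rightarrow> ('v \<Rightarrow> 'v) \<Rightarrow> 'v set \<Rightarrow> bool" where
  "submodule m n smul X K D W =
    (0 \<in> W \<and> (\<forall>v\<in>W. \<forall>w\<in>W. v + w \<in> W) \<and> (\<forall>c. \<forall>v\<in>W. smul c v \<in> W) \<and>
     (\<forall>r a. \<forall>v\<in>W. slmat m n a \<longrightarrow> X r a v \<in> W) \<and>
     (\<forall>v\<in>W. K v \<in> W) \<and> (\<forall>v\<in>W. D v \<in> W))"

definition irreducible_rep :: "nat \<Rightarrow> nat \<Rightarrow> (complex \<Rightarrow> 'v::ab_group_add \<Rightarrow> 'v)
   \<Rightarrow> (int \<Rightarrow> cmat \<Rightarrow> 'v \<Rightarrow> 'v) \<Rightarrow> ('v \<Rightarrow> 'v) \<Rightarrow> ('v \<Rightarrow> 'v) \<Rightarrow> bool" where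
  "irreducible_rep m n smul X K D =
    ((\<exists>v::'v. v \<noteq> 0) \<and>
     (\<forall>W. submodule m n smul X K D W \<longrightarrow> W = {0} \<or> W = UNIV))"

text \<open>Highest weight vector of weight Lambda in hat-h^*; Lambda is given by
 lam (its restriction to h, as a function of the diagonal), lk = Lambda(K), ld = Lambda(d).\<close>
definition hw_vector :: "nat \<Rightarrow> nat \<Rightarrow> (complex \<Rightarrow> 'v::ab_group_add \<Rightarrow> 'v)
   \<Rightarrow> (int \<Rightarrow> cmat \<Rightarrow> 'v \<Rightarrow> 'v) \<Rightarrow> ('v \<Rightarrow> 'v) \<Rightarrow> ('v \<Rightarrow> 'v)
   \<Rightarrow> ((nat \<Rightarrow> complex) \<Rightarrow> complex) \<Rightarrow> complex \<Rightarrow> complex \<Rightarrow> 'v \<Rightarrow> bool" where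
  "hw_vector m n smul X K D lam lk ld v =
    (v \<noteq> 0 \<and>
     (\<forall>h. sldiag m n h \<longrightarrow> X 0 (diagmat h) v = smul (lam h) v) \<and>
     K v = smul lk v \<and> D v = smul ld v \<and>
     (\<forall>a. slmat m n a \<and> upper m n a \<longrightarrow> X 0 a v = 0) \<and>
     (\<forall>r a. r > 0 \<and> slmat m n a \<longrightarrow> X r a v = 0))"

definition is_L :: "nat \<Rightarrow> nat \<Rightarrow> (complex \<Rightarrow> 'v::ab_group_add \<Rightarrow> 'v)
   \<Rightarrow> (int \<Rightarrow> cmat \<Rightarrow> 'v \<Rightarrow> 'v) \<Rightarrow> ('v \<Rightarrow> 'v) \<Rightarrow> ('v \<Rightarrow> 'v)
   \<Rightarrow> ((nat \<Rightarrow> complex) \<Rightarrow> complex) \<Rightarrow> complex \<Rightarrow> complex \<Rightarrow> bool" where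
  "is_L m n smul X K D lam lk ld =
    (affine_rep m n smul X K D \<and> irreducible_rep m n smul X K D \<and>
     (\<exists>v. hw_vector m n smul X K D lam lk ld v))"

definition loc_nilp :: "('v::zero \<Rightarrow> 'v) \<Rightarrow> bool" where
  "loc_nilp f = (\<forall>v. \<exists>N. (f ^^ N) v = 0)"

text \<open>Integrability w.r.t. g#_0 = sl(m+1) (roots eps_i - eps_j): root vector of
 -gamma for gamma = eps_i - eps_j (+ r delta) is E_ji t^(-r).\<close>
definition integrable :: "nat \<Rightarrow> nat \<Rightarrow> (int \<Rightarrow> cmat \<Rightarrow> 'v::zero \<Rightarrow> 'v) \<Rightarrow> bool" where
  "integrable m n X =
    (\<forall>i j. i \<le> m \<and> j \<le> m \<and> i \<noteq> j \<longrightarrow>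
       ((pos m n i < pos m n j \<longrightarrow> loc_nilp (X 0 (Emat j i))) \<and>
        (\<forall>r::int. r > 0 \<longrightarrow> loc_nilp (X (- r) (Emat j i)))))"

end

(* The simple roots of the affinization of sl(m+1) are delta - theta, the roots
   eps_i - eps_(i+1) with i > n, which are simple for the given system, and the roots
   eps_i - eps_(i+1) with i <= n, which are not. But (Lambda|beta_i) = 0 forces the root vector
   of -beta_i to kill the highest weight vector v, so v is also a highest weight vector for the
   system reflected in beta_i, where eps_i - eps_(i+1) is simple. Hence for each of these roots
   gamma, the root vector of -gamma is nilpotent on v iff the coroot of gamma takes a natural
   value on Lambda: if it does, the first string vector that v should not reach is singular of
   lower weight, hence zero by irreducibility; the converse is sl(2)-theory. Nilpotency on v
   gives local nilpotency on L(Lambda), because ad of a root vector is nilpotent.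

   Local nilpotency spreads from the simple to all real roots: if F and A_0 are locally nilpotent
   and (ad F)^(d+1) A_0 = 0, then A_d = (ad F)^d A_0 / d! is locally nilpotent, because
   (ad F)^(dN) (A_0^N) is a nonzero multiple of A_d^N, while F^a A_0^N F^b v vanishes for all a, b
   once N is large. Finally Lambda vanishes on the coroots of the beta_i, so it is determined by
   its values k_i on E_ii - E_(m+1,m+1), and the simple coroots take the values k_i - k_(i+1), k_m
   and k - k_1. *)

theory Submission
  imports Defs
begin

section \<open>Locally nilpotent operators\<close>

locale complex_space = vector_space smul
  for smul :: "complex \<Rightarrow> 'v::ab_group_add \<Rightarrow> 'v"
begin

abbreviation lin :: "('v \<Rightarrow> 'v) \<Rightarrow> bool" where
  "lin f \<equiv> Vector_Spaces.linear smul smul f"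

lemma lin_simps:
  assumes "lin f"
  shows "f (u + w) = f u + f w" "f (smul c u) = smul c (f u)" "f 0 = 0"
    "f (u - w) = f u - f w" "f (- u) = - f u" "f (sum g A) = (\<Sum>i\<in>A. f (g i))"
proof -
  interpret l: Vector_Spaces.linear smul smul f by fact
  show "f (u + w) = f u + f w" "f (smul c u) = smul c (f u)" "f 0 = 0"
    "f (u - w) = f u - f w" "f (- u) = - f u" "f (sum g A) = (\<Sum>i\<in>A. f (g i))"
    by (simp_all add: l.add l.scale l.diff l.neg l.zero l.sum)
qed

lemma lin_funpow: "lin f \<Longrightarrow> (f ^^ N) (u + w) = (f ^^ N) u + (f ^^ N) w"
  "lin f \<Longrightarrow> (f ^^ N) (smul c u) = smul c ((f ^^ N) u)"
  "lin f \<Longrightarrow> (f ^^ N) 0 = 0"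
  by (induction N) (simp_all add: lin_simps)

lemma funpow_zero_mono:
  assumes "lin f" "(f ^^ N) u = 0" "N \<le> M"
  shows "(f ^^ M) u = 0"
proof -
  have "(f ^^ M) u = (f ^^ (M - N)) ((f ^^ N) u)"
    using assms(3) by (metis comp_apply funpow_add le_add_diff_inverse2)
  then show ?thesis using assms lin_funpow(3) by simp
qed

section \<open>Vectors on which an operator acts nilpotently\<close>

definition nil_set :: "('v \<Rightarrow> 'v) \<Rightarrow> 'v set" where
  "nil_set f = {u. \<exists>N. (f ^^ N) u = 0}"

lemma nil_set_0: "0 \<in> nil_set f"
  unfolding nil_set_def by (auto intro: exI[of _ 0])

lemma nil_set_add:
  assumes "lin f" "u \<in> nil_set f" "w \<in> nil_set f"
  shows "u + w \<in> nil_set f"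
proof -
  obtain N M where "(f ^^ N) u = 0" "(f ^^ M) w = 0"
    using assms unfolding nil_set_def by auto
  then have "(f ^^ (max N M)) u = 0" "(f ^^ (max N M)) w = 0"
    using funpow_zero_mono[OF assms(1)] by auto
  then have "(f ^^ (max N M)) (u + w) = 0"
    by (simp add: lin_funpow[OF assms(1)])
  then show ?thesis unfolding nil_set_def by blast
qed

lemma nil_set_smul:
  assumes "lin f" "u \<in> nil_set f"
  shows "smul c u \<in> nil_set f"
  using assms by (auto simp: nil_set_def lin_funpow)

lemma nil_set_self:
  assumes "lin f" "u \<in> nil_set f"
  shows "f u \<in> nil_set f"
proof -
  obtain N where "(f ^^ N) u = 0" using assms unfolding nil_set_def by auto
  then have "(f ^^ N) (f u) = 0"
    using assms(1) by (metis funpow_swap1 lin_simps(3))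
  then show ?thesis unfolding nil_set_def by blast
qed

text \<open>Induction on the exponent that kills \<open>u\<close>: \<open>f u\<close> has a smaller
  one, so both summands of \<open>f (B u) = B (f u) + C u\<close> lie in \<open>nil_set f\<close>,
  and then so does \<open>B u\<close>. This allows climbing back along iterated commutators with
  \<open>f\<close>.\<close>

lemma nil_set_preserved:
  assumes "lin f"
    and comm: "\<And>w. f (B w) = B (f w) + C w" and "B 0 = 0"
    and C: "\<And>w. w \<in> nil_set f \<Longrightarrow> C w \<in> nil_set f"
    and "u \<in> nil_set f"
  shows "B u \<in> nil_set f"
proof -
  have "(f ^^ N) u = 0 \<Longrightarrow> B u \<in> nil_set f" for N u
  proof (induction N arbitrary: u)
    case 0
    then show ?case using \<open>B 0 = 0\<close> nil_set_0 by simp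
  next
    case (Suc N)
    have "(f ^^ N) (f u) = 0" using Suc.prems by (simp add: funpow_swap1)
    then have "B (f u) \<in> nil_set f" by (rule Suc.IH)
    moreover have "C u \<in> nil_set f"
      using Suc.prems by (intro C) (auto simp: nil_set_def intro: exI[of _ "Suc N"])
    ultimately have "f (B u) \<in> nil_set f"
      unfolding comm using nil_set_add[OF assms(1)] by blast
    then obtain M where "(f ^^ M) (f (B u)) = 0" unfolding nil_set_def by auto
    then have "(f ^^ Suc M) (B u) = 0" by (simp add: funpow_swap1)
    then show ?case unfolding nil_set_def by blast
  qed
  then show ?thesis using assms(5) unfolding nil_set_def by auto
qed

text \<open>For a sequence of operators with \<open>(ad F) (A i) = (i + 1) A (i + 1)\<close>, the operator
  \<open>F\<close> acts as \<open>d/dt\<close> on powers of \<open>A(t) = (\<Sum>i. t ^ i A i)\<close>;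
  \<open>pow_coeff A N k\<close> is the coefficient of \<open>t ^ k\<close> in \<open>A(t) ^ N\<close>.\<close>

fun pow_coeff :: "(nat \<Rightarrow> 'v \<Rightarrow> 'v) \<Rightarrow> nat \<Rightarrow> nat \<Rightarrow> 'v \<Rightarrow> 'v" where
  "pow_coeff A 0 k = (\<lambda>u. if k = 0 then u else 0)"
| "pow_coeff A (Suc N) k = (\<lambda>u. \<Sum>i\<le>k. A i (pow_coeff A N (k - i) u))"

lemma pow_coeff_ad:
  assumes F: "lin F" and A: "\<And>i. lin (A i)"
    and FA: "\<And>i u. F (A i u) = A i (F u) + smul (of_nat (i + 1)) (A (i + 1) u)"
  shows "F (pow_coeff A N k u) =
    pow_coeff A N k (F u) + smul (of_nat (k + 1)) (pow_coeff A N (k + 1) u)"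
proof (induction N arbitrary: k)
  case 0
  then show ?case by (simp add: lin_simps[OF F])
next
  case (Suc N)
  let ?c = "pow_coeff A N"
  have "F (pow_coeff A (Suc N) k u) = (\<Sum>i\<le>k. F (A i (?c (k - i) u)))"
    by (simp add: lin_simps[OF F])
  also have "\<dots> = (\<Sum>i\<le>k. A i (?c (k - i) (F u))
      + smul (of_nat (k - i + 1)) (A i (?c (k - i + 1) u))
      + smul (of_nat (i + 1)) (A (i + 1) (?c (k - i) u)))"
    by (intro sum.cong refl) (simp only: FA Suc.IH lin_simps[OF A])
  also have "\<dots> = pow_coeff A (Suc N) k (F u)
      + ((\<Sum>i\<le>k. smul (of_nat (k + 1 - i)) (A i (?c (k + 1 - i) u)))
      + (\<Sum>i\<le>k. smul (of_nat (i + 1)) (A (i + 1) (?c (k - i) u))))"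
    by (simp add: sum.distrib Suc_diff_le add.assoc)
  \<comment> \<open>Both sums are extended to \<open>i \<le> k + 1\<close> by a term with
    coefficient 0 (the second after an index shift), so that the weights \<open>k + 1 - i\<close>
    and \<open>i\<close> add up to the constant \<open>k + 1\<close>.\<close>
  also have "(\<Sum>i\<le>k. smul (of_nat (k + 1 - i)) (A i (?c (k + 1 - i) u)))
     = (\<Sum>i\<le>k + 1. smul (of_nat (k + 1 - i)) (A i (?c (k + 1 - i) u)))"
    by simp
  also have "(\<Sum>i\<le>k. smul (of_nat (i + 1)) (A (i + 1) (?c (k - i) u)))
     = (\<Sum>i\<le>k + 1. smul (of_nat i) (A i (?c (k + 1 - i) u)))"
    unfolding Suc_eq_plus1[symmetric] sum.atMost_Suc_shift by simp
  also have "(\<Sum>i\<le>k + 1. smul (of_nat (k + 1 - i)) (A i (?c (k + 1 - i) u)))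
     + (\<Sum>i\<le>k + 1. smul (of_nat i) (A i (?c (k + 1 - i) u)))
     = (\<Sum>i\<le>k + 1. smul (of_nat (k + 1)) (A i (?c (k + 1 - i) u)))"
    unfolding sum.distrib[symmetric]
    by (intro sum.cong refl)
      (simp only: scale_left_distrib[symmetric] of_nat_add[symmetric] atMost_iff le_add_diff_inverse2)
  also have "\<dots> = smul (of_nat (k + 1)) (pow_coeff A (Suc N) (k + 1) u)"
    by (simp only: scale_sum_right pow_coeff.simps)
  finally show ?case .
qed

lemma pow_coeff_0: "pow_coeff A N 0 u = (A 0 ^^ N) u"
  by (induction N) simp_all

text \<open>\<open>A(t)\<close> is a polynomial of degree at most \<open>d\<close>, so
  \<open>A(t) ^ N\<close> has degree at most \<open>d * N\<close>.\<close>

lemma pow_coeff_zero_above: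
  assumes A: "\<And>i. lin (A i)" and top: "\<And>i u. i > d \<Longrightarrow> A i u = 0"
  shows "k > d * N \<Longrightarrow> pow_coeff A N k u = 0"
proof (induction N arbitrary: k)
  case (Suc N)
  have "A i (pow_coeff A N (k - i) u) = 0" if "i \<le> k" for i
  proof (cases "i > d")
    case False
    then have "k - i > d * N" using Suc.prems by simp
    then show ?thesis by (simp add: Suc.IH lin_simps[OF A])
  qed (simp add: top)
  then show ?case by simp
qed simp

text \<open>The leading coefficient of a power: for \<open>i < d\<close> the remaining factor lies
  above degree \<open>d * N\<close>, and for \<open>i > d\<close> the factor \<open>A i\<close>
  vanishes.\<close>

lemma pow_coeff_top:
  assumes A: "\<And>i. lin (A i)" and top: "\<And>i u. i > d \<Longrightarrow> A i u = 0"
  shows "pow_coeff A N (d * N) u = (A d ^^ N) u"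
proof (induction N)
  case (Suc N)
  have "A i (pow_coeff A N (d * Suc N - i) u) = (if i = d then A d ((A d ^^ N) u) else 0)"
    for i
  proof (cases i d rule: linorder_cases)
    case less
    then show ?thesis
      using pow_coeff_zero_above[where A = A and d = d and N = N
          and k = "d * Suc N - i" and u = u, OF A top]
      by (simp add: lin_simps[OF A])
  next
    case equal
    then show ?thesis using Suc.IH by simp
  qed (simp add: top)
  then have "pow_coeff A (Suc N) (d * Suc N) u
      = (\<Sum>i\<le>d * Suc N. if i = d then A d ((A d ^^ N) u) else 0)"
    by simp
  then show ?case by simp
qed simp

text \<open>Once the lowest coefficient of \<open>A(t) ^ N\<close> vanishes on the whole
  \<open>F\<close>-string of \<open>v\<close>, commuting with \<open>F\<close> carries this to all
  higher coefficients, up to the leading one, which is the \<open>N\<close>-th power of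
  \<open>A d\<close>.\<close>

lemma nilpotent_ladder:
  assumes F: "lin F" and A: "\<And>i. lin (A i)"
    and FA: "\<And>i u. F (A i u) = A i (F u) + smul (of_nat (i + 1)) (A (i + 1) u)"
    and top: "\<And>i u. i > d \<Longrightarrow> A i u = 0"
    and nil: "loc_nilp F" "loc_nilp (A 0)"
  shows "loc_nilp (A d)"
  unfolding loc_nilp_def
proof
  fix v
  obtain s where s: "(F ^^ s) v = 0" using nil(1) unfolding loc_nilp_def by blast
  \<comment> \<open>One exponent has to serve all of the string; from \<open>j = s\<close> on its
    vectors are zero.\<close>
  have "\<exists>N. \<forall>j<t. (A 0 ^^ N) ((F ^^ j) v) = 0" for t
  proof (induction t)
    case (Suc t)
    then obtain N where N: "\<forall>j<t. (A 0 ^^ N) ((F ^^ j) v) = 0" by blast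
    obtain M where M: "(A 0 ^^ M) ((F ^^ t) v) = 0"
      using nil(2) unfolding loc_nilp_def by blast
    have "\<forall>j<Suc t. (A 0 ^^ max N M) ((F ^^ j) v) = 0"
      using N M funpow_zero_mono[OF A[of 0]] by (metis less_Suc_eq max.cobounded1 max.cobounded2)
    then show ?case by blast
  qed simp
  then obtain N where N: "\<forall>j<s. (A 0 ^^ N) ((F ^^ j) v) = 0" by blast
  \<comment> \<open>\<open>j\<close> varies in the induction: coefficient \<open>k + 1\<close> on
    \<open>(F ^^ j) v\<close> is controlled by coefficient \<open>k\<close> on both
    \<open>(F ^^ j) v\<close> and \<open>(F ^^ Suc j) v\<close>.\<close>
  have "pow_coeff A N k ((F ^^ j) v) = 0" for k j
  proof (induction k arbitrary: j)
    case 0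
    show ?case
    proof (cases "j < s")
      case False
      then have "(F ^^ j) v = 0" using funpow_zero_mono[OF F s] by simp
      then show ?thesis by (simp add: pow_coeff_0 lin_funpow[OF A])
    qed (simp add: pow_coeff_0 N)
  next
    case (Suc k)
    have "F (pow_coeff A N k ((F ^^ j) v)) = pow_coeff A N k ((F ^^ Suc j) v)
        + smul (of_nat (k + 1)) (pow_coeff A N (k + 1) ((F ^^ j) v))"
      using pow_coeff_ad[OF F A FA] by simp
    then have "smul (of_nat (k + 1)) (pow_coeff A N (k + 1) ((F ^^ j) v)) = 0"
      by (simp only: Suc.IH lin_simps[OF F] add_0_left)
    then show ?case by (simp only: scale_eq_0_iff of_nat_eq_0_iff) simp
  qed
  from this[of "d * N" 0] have "(A d ^^ N) v = 0"
    using pow_coeff_top[OF A top] by simp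
  then show "\<exists>N. (A d ^^ N) v = 0" by blast
qed

text \<open>\<open>(f ^^ j) v\<close> has \<open>h\<close>-eigenvalue \<open>c - 2 * j\<close>;
  moving \<open>e\<close> through the string adds these up for \<open>j = 0, ..., k\<close>, which
  gives \<open>(k + 1) * (c - k)\<close>.\<close>

lemma sl2_raise:
  assumes e: "lin e" and f: "lin f" and h: "lin h"
    and ef: "\<And>u. e (f u) = f (e u) + h u"
    and hf: "\<And>u. h (f u) = f (h u) - smul 2 (f u)"
    and v: "e v = 0" "h v = smul c v"
  shows "e ((f ^^ Suc k) v) = smul (of_nat (Suc k) * (c - of_nat k)) ((f ^^ k) v)"
proof -
  have hw: "h ((f ^^ k) v) = smul (c - 2 * of_nat k) ((f ^^ k) v)" for k
  proof (induction k)
    case (Suc k)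
    have "h ((f ^^ Suc k) v) = smul (c - 2 * of_nat k) ((f ^^ Suc k) v) - smul 2 ((f ^^ Suc k) v)"
      by (simp add: hf Suc.IH lin_simps[OF f])
    then show ?case
      by (simp only: scale_left_diff_distrib[symmetric]) (simp add: algebra_simps)
  qed (simp add: v)
  show ?thesis
  proof (induction k)
    case 0
    then show ?case by (simp add: ef v lin_simps[OF f])
  next
    case (Suc k)
    have "e ((f ^^ Suc (Suc k)) v) = f (e ((f ^^ Suc k) v)) + h ((f ^^ Suc k) v)"
      by (simp add: ef)
    also have "\<dots> = smul (of_nat (Suc k) * (c - of_nat k)) ((f ^^ Suc k) v)
        + smul (c - 2 * of_nat (Suc k)) ((f ^^ Suc k) v)"
      unfolding Suc.IH hw lin_simps[OF f] by simp
    also have "\<dots> = smul (of_nat (Suc (Suc k)) * (c - of_nat (Suc k))) ((f ^^ Suc k) v)"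
      by (simp only: scale_left_distrib[symmetric]) (simp add: algebra_simps)
    finally show ?case .
  qed
qed

text \<open>At the last nonzero vector \<open>(f ^^ k) v\<close> of the string the scalar of
  \<open>sl2_raise\<close> must vanish, and its factor \<open>k + 1\<close> does not.\<close>

lemma sl2_nilpotent_imp_nat:
  assumes "lin e" "lin f" "lin h"
    and "\<And>u. e (f u) = f (e u) + h u"
    and "\<And>u. h (f u) = f (h u) - smul 2 (f u)"
    and "e v = 0" "h v = smul c v" and "v \<noteq> 0" and "(f ^^ N) v = 0"
  shows "\<exists>k::nat. c = of_nat k"
proof -
  define M where "M = (LEAST N. (f ^^ N) v = 0)"
  have M0: "(f ^^ M) v = 0" unfolding M_def using assms(9) by (rule LeastI)
  then obtain k where k: "M = Suc k" using \<open>v \<noteq> 0\<close> by (cases M) auto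
  have "(f ^^ k) v \<noteq> 0" using not_less_Least[of k "\<lambda>N. (f ^^ N) v = 0"] k M_def by simp
  moreover have "smul (of_nat (Suc k) * (c - of_nat k)) ((f ^^ k) v) = 0"
    using sl2_raise[OF assms(1-7), of k] M0 k lin_simps(3)[OF assms(1)] by simp
  ultimately have "of_nat (Suc k) * (c - of_nat k) = 0" by (simp only: scale_eq_0_iff) simp
  then show ?thesis by (metis eq_iff_diff_eq_0 mult_eq_0_iff of_nat_neq_0)
qed

end

section \<open>Supermatrices graded by an ordering of the coordinates\<close>

definition sgi :: "nat \<Rightarrow> nat \<Rightarrow> complex" where
  "sgi m i = (if odd_idx m i then -1 else 1)"

lemma str_eq_sum: "str m n a = (\<Sum>i<dimN m n. sgi m i * a i i)"
proof -
  have *: "{..<dimN m n} = {..<m + 1} \<union> {m + 1..<dimN m n}"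
    by (auto simp: dimN_def)
  have "(\<Sum>i\<in>{m + 1..<dimN m n}. sgi m i * a i i) = - (\<Sum>i\<in>{m + 1..<dimN m n}. a i i)"
    unfolding sum_negf[symmetric] by (intro sum.cong) (auto simp: sgi_def odd_idx_def)
  moreover have "(\<Sum>i<m + 1. sgi m i * a i i) = (\<Sum>i<m + 1. a i i)"
    by (intro sum.cong) (auto simp: sgi_def odd_idx_def)
  ultimately show ?thesis
    unfolding str_def * by (subst sum.union_disjoint) auto
qed

text \<open>\<open>s = 1\<close> serves brackets with an even factor, \<open>s = -1\<close> those of
  two odd matrices. The hypothesis concerns entries only, so a factor may have mixed parity.\<close>

lemma str_matmul_swap:
  assumes "\<And>i k. a i k \<noteq> 0 \<Longrightarrow> b k i \<noteq> 0 \<Longrightarrow> sgi m i = s * sgi m k"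
  shows "str m n (matmul m n a b) = s * str m n (matmul m n b a)"
proof -
  have "str m n (matmul m n a b) = (\<Sum>i<dimN m n. \<Sum>k<dimN m n. sgi m i * (a i k * b k i))"
    by (simp add: str_eq_sum matmul_def sum_distrib_left)
  also have "\<dots> = (\<Sum>i<dimN m n. \<Sum>k<dimN m n. s * (sgi m k * (b k i * a i k)))"
  proof (intro sum.cong refl)
    fix i k
    show "sgi m i * (a i k * b k i) = s * (sgi m k * (b k i * a i k))"
      using assms[of i k] by (cases "a i k = 0 \<or> b k i = 0") auto
  qed
  also have "\<dots> = (\<Sum>k<dimN m n. \<Sum>i<dimN m n. s * (sgi m k * (b k i * a i k)))"
    by (rule sum.swap)
  finally show ?thesis
    by (simp add: str_eq_sum matmul_def sum_distrib_left)
qed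

lemma str_comb: "str m n (\<lambda>i j. c * a i j + b i j) = c * str m n a + str m n b"
  by (simp add: str_eq_sum sum.distrib sum_distrib_left algebra_simps)

lemma slmat_comb: "slmat m n a \<Longrightarrow> slmat m n b \<Longrightarrow> slmat m n (\<lambda>i j. c * a i j + b i j)"
  by (simp add: slmat_def str_comb is_mat_def)

lemma slmat_zero: "slmat m n (\<lambda>_ _. 0)"
  by (simp add: slmat_def is_mat_def str_def)

lemma slmat_add: "slmat m n a \<Longrightarrow> slmat m n b \<Longrightarrow> slmat m n (\<lambda>i j. a i j + b i j)"
  using slmat_comb[of m n a b 1] by simp

lemma is_mat_matmul: "is_mat m n a \<Longrightarrow> is_mat m n b \<Longrightarrow> is_mat m n (matmul m n a b)"
  by (auto simp: is_mat_def matmul_def)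

text \<open>The superbracket with an even first argument; it makes sense for a second argument of
  mixed parity.\<close>

definition com :: "nat \<Rightarrow> nat \<Rightarrow> cmat \<Rightarrow> cmat \<Rightarrow> cmat" where
  "com m n a b = (\<lambda>i j. matmul m n a b i j - matmul m n b a i j)"

lemma sbr_False: "sbr m n False p a b = com m n a b"
  by (simp add: sbr_def com_def)

lemma slmat_com:
  assumes "slmat m n a" "slmat m n b" "homog m False a"
  shows "slmat m n (com m n a b)"
proof -
  have "str m n (matmul m n a b) = 1 * str m n (matmul m n b a)"
    using assms(3) by (intro str_matmul_swap) (auto simp: sgi_def homog_def)
  then have "str m n (\<lambda>i j. (-1) * matmul m n b a i j + matmul m n a b i j) = 0"
    unfolding str_comb by simp
  then have "str m n (com m n a b) = 0" by (simp add: com_def)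
  then show ?thesis
    using assms is_mat_matmul[of m n a b] is_mat_matmul[of m n b a]
    by (auto simp: slmat_def com_def is_mat_def)
qed

text \<open>The index permutation \<open>\<pi>\<close> plays the role of a choice of simple roots: \<open>\<epsilon>\<^sub>i - \<epsilon>\<^sub>j\<close> is positive
  iff \<open>\<pi> i < \<pi> j\<close>, and its height is \<open>\<pi> j - \<pi> i\<close>.\<close>

definition graded :: "nat \<Rightarrow> nat \<Rightarrow> (nat \<Rightarrow> nat) \<Rightarrow> bool \<Rightarrow> int \<Rightarrow> cmat \<Rightarrow> bool" where
  "graded m n \<pi> p d a \<longleftrightarrow> slmat m n a \<and> homog m p a \<and>
     (\<forall>i j. a i j \<noteq> 0 \<longrightarrow> int (\<pi> j) - int (\<pi> i) = d)"

lemma matmul_nz: "matmul m n a b i j \<noteq> 0 \<Longrightarrow> \<exists>k<dimN m n. a i k \<noteq> 0 \<and> b k j \<noteq> 0"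
  unfolding matmul_def by (rule ccontr) (auto intro: sum.neutral)

lemma sbr_nz:
  assumes "sbr m n pa pb a b i j \<noteq> 0"
  shows "(\<exists>k. a i k \<noteq> 0 \<and> b k j \<noteq> 0) \<or> (\<exists>k. b i k \<noteq> 0 \<and> a k j \<noteq> 0)"
proof -
  have "matmul m n a b i j \<noteq> 0 \<or> matmul m n b a i j \<noteq> 0"
    using assms unfolding sbr_def by auto
  then show ?thesis using matmul_nz by blast
qed

lemma graded_sbr:
  assumes a: "graded m n \<pi> pa d a" and b: "graded m n \<pi> pb e b"
  shows "graded m n \<pi> (pa \<noteq> pb) (d + e) (sbr m n pa pb a b)"
proof -
  let ?s = "if pa \<and> pb then -1 else 1 :: complex"
  have "str m n (matmul m n a b) = ?s * str m n (matmul m n b a)"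
    using a b by (intro str_matmul_swap) (auto simp: sgi_def homog_def graded_def)
  then have "str m n (\<lambda>i j. (- ?s) * matmul m n b a i j + matmul m n a b i j) = 0"
    unfolding str_comb by simp
  then have "str m n (sbr m n pa pb a b) = 0" by (cases pa; cases pb) (simp_all add: sbr_def add.commute)
  then have "slmat m n (sbr m n pa pb a b)"
    using a b is_mat_matmul[of m n a b] is_mat_matmul[of m n b a]
    by (auto simp: slmat_def sbr_def is_mat_def graded_def)
  moreover have "homog m (pa \<noteq> pb) (sbr m n pa pb a b)"
    unfolding homog_def
  proof (intro allI impI, rule ccontr)
    fix i j assume ij: "(odd_idx m i \<noteq> odd_idx m j) \<noteq> (pa \<noteq> pb)" "sbr m n pa pb a b i j \<noteq> 0"
    have ha: "a i k \<noteq> 0 \<Longrightarrow> (odd_idx m i \<noteq> odd_idx m k) = pa"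
      and hb: "b i k \<noteq> 0 \<Longrightarrow> (odd_idx m i \<noteq> odd_idx m k) = pb" for i k
      using a b by (auto simp: graded_def homog_def)
    from sbr_nz[OF ij(2)] show False
    proof (elim disjE exE conjE)
      fix k assume "a i k \<noteq> 0" "b k j \<noteq> 0"
      from ha[OF this(1)] hb[OF this(2)] show False using ij(1) by blast
    next
      fix k assume "b i k \<noteq> 0" "a k j \<noteq> 0"
      from hb[OF this(1)] ha[OF this(2)] show False using ij(1) by blast
    qed
  qed
  moreover have "int (\<pi> j) - int (\<pi> i) = d + e" if "sbr m n pa pb a b i j \<noteq> 0" for i j
  proof -
    have ha: "a i k \<noteq> 0 \<Longrightarrow> int (\<pi> k) - int (\<pi> i) = d"
      and hb: "b i k \<noteq> 0 \<Longrightarrow> int (\<pi> k) - int (\<pi> i) = e" for i k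
      using a b by (auto simp: graded_def)
    from sbr_nz[OF that] show ?thesis
    proof (elim disjE exE conjE)
      fix k assume "a i k \<noteq> 0" "b k j \<noteq> 0"
      from ha[OF this(1)] hb[OF this(2)] show ?thesis by simp
    next
      fix k assume "b i k \<noteq> 0" "a k j \<noteq> 0"
      from hb[OF this(1)] ha[OF this(2)] show ?thesis by simp
    qed
  qed
  ultimately show ?thesis by (simp add: graded_def)
qed

text \<open>Reduces additive statements to homogeneous matrices: \<open>a\<close> is cut into
  finitely many blocks \<open>g x\<close> by parity and height.\<close>

lemma graded_decompose:
  assumes a: "slmat m n a"
    and P: "\<And>p d b. graded m n \<pi> p d b \<Longrightarrow> P b"
    and add: "\<And>b c. slmat m n b \<Longrightarrow> slmat m n c \<Longrightarrow> P b \<Longrightarrow> P c \<Longrightarrow> P (\<lambda>i j. b i j + c i j)"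
  shows "P a"
proof -
  define g where "g x = (\<lambda>i j. if (odd_idx m i \<noteq> odd_idx m j, int (\<pi> j) - int (\<pi> i)) = x
    then a i j else 0)" for x
  have gg: "graded m n \<pi> (fst x) (snd x) (g x)" for x
  proof -
    \<comment> \<open>All diagonal entries lie in the even block of height 0, which inherits the
      supertrace of \<open>a\<close>; the other blocks have none.\<close>
    have "str m n (g x) = (if x = (False, 0) then str m n a else 0)"
      by (simp add: str_eq_sum g_def)
    then have "slmat m n (g x)" using a by (auto simp: slmat_def is_mat_def g_def)
    then show ?thesis unfolding graded_def homog_def g_def by auto
  qed
  have fin: "slmat m n (\<lambda>i j. \<Sum>x\<in>F. g x i j) \<and> P (\<lambda>i j. \<Sum>x\<in>F. g x i j)" if "finite F" for F
    using that
  proof induction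
    case empty
    show ?case using P[of False 0 "\<lambda>_ _. 0"] slmat_zero by (simp add: graded_def homog_def)
  next
    case (insert x F)
    have "slmat m n (g x)" using gg[of x] by (simp add: graded_def)
    then show ?case using insert slmat_add[of m n "g x"] add[of "g x"] P[OF gg] by simp
  qed
  define B where "B = int (\<Sum>i<dimN m n. \<pi> i)"
  let ?F = "(UNIV :: bool set) \<times> {-B..B}"
  have "(\<lambda>i j. \<Sum>x\<in>?F. g x i j) = a"
  proof (intro ext)
    fix i j
    show "(\<Sum>x\<in>?F. g x i j) = a i j"
    proof (cases "i < dimN m n \<and> j < dimN m n")
      case True
      then have "int (\<pi> i) \<le> B" "int (\<pi> j) \<le> B"
        unfolding B_def by (auto intro!: member_le_sum)
      then have "(odd_idx m i \<noteq> odd_idx m j, int (\<pi> j) - int (\<pi> i)) \<in> ?F" by auto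
      then show ?thesis unfolding g_def by (subst sum.delta') auto
    next
      case False
      then have "a i j = 0" using a by (auto simp: slmat_def is_mat_def)
      then show ?thesis by (simp add: g_def)
    qed
  qed
  then show ?thesis using fin[of ?F] by simp
qed

section \<open>Products with matrix units and diagonal matrices\<close>

lemma matmul_Emat_right: "i < dimN m n \<Longrightarrow> matmul m n a (Emat i j) = (\<lambda>x y. if y = j then a x i else 0)"
proof (intro ext)
  fix x y assume "i < dimN m n"
  have "matmul m n a (Emat i j) x y = (\<Sum>k<dimN m n. if k = i then (if y = j then a x i else 0) else 0)"
    unfolding matmul_def Emat_def by (intro sum.cong) auto
  then show "matmul m n a (Emat i j) x y = (if y = j then a x i else 0)"
    using \<open>i < dimN m n\<close> by simp
qed

lemma matmul_Emat_left: "j < dimN m n \<Longrightarrow> matmul m n (Emat i j) a = (\<lambda>x y. if x = i then a j y else 0)"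
proof (intro ext)
  fix x y assume "j < dimN m n"
  have "matmul m n (Emat i j) a x y = (\<Sum>k<dimN m n. if k = j then (if x = i then a j y else 0) else 0)"
    unfolding matmul_def Emat_def by (intro sum.cong) auto
  then show "matmul m n (Emat i j) a x y = (if x = i then a j y else 0)"
    using \<open>j < dimN m n\<close> by simp
qed

lemma matmul_diagmat_left: "is_mat m n a \<Longrightarrow> matmul m n (diagmat h) a = (\<lambda>x y. h x * a x y)"
proof (intro ext)
  fix x y assume a: "is_mat m n a"
  have "matmul m n (diagmat h) a x y = (\<Sum>k<dimN m n. if k = x then h x * a x y else 0)"
    unfolding matmul_def diagmat_def by (intro sum.cong) auto
  then show "matmul m n (diagmat h) a x y = h x * a x y"
    using a by (auto simp: is_mat_def)
qed

lemma matmul_diagmat_right: "is_mat m n a \<Longrightarrow> matmul m n a (diagmat h) = (\<lambda>x y. h y * a x y)"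
proof (intro ext)
  fix x y assume a: "is_mat m n a"
  have "matmul m n a (diagmat h) x y = (\<Sum>k<dimN m n. if k = y then h y * a x y else 0)"
    unfolding matmul_def diagmat_def by (intro sum.cong) auto
  then show "matmul m n a (diagmat h) x y = h y * a x y"
    using a by (auto simp: is_mat_def)
qed

lemma com_diagmat: "is_mat m n a \<Longrightarrow> com m n (diagmat h) a = (\<lambda>x y. (h x - h y) * a x y)"
  by (simp add: com_def matmul_diagmat_left matmul_diagmat_right algebra_simps)

lemma is_mat_Emat: "i < dimN m n \<Longrightarrow> j < dimN m n \<Longrightarrow> is_mat m n (Emat i j)"
  by (auto simp: is_mat_def Emat_def)

lemma str_Emat: "i < dimN m n \<Longrightarrow> str m n (Emat i j) = (if i = j then sgi m i else 0)"
proof -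
  assume "i < dimN m n"
  have "str m n (Emat i j) = (\<Sum>x<dimN m n. if x = i then if i = j then sgi m i else 0 else 0)"
    unfolding str_eq_sum Emat_def by (intro sum.cong) auto
  then show ?thesis using \<open>i < dimN m n\<close> by simp
qed

lemma graded_Emat:
  assumes "i < dimN m n" "j < dimN m n" "i \<noteq> j"
  shows "graded m n \<pi> (odd_idx m i \<noteq> odd_idx m j) (int (\<pi> j) - int (\<pi> i)) (Emat i j)"
  using assms is_mat_Emat[of i m n j] str_Emat[of i m n j]
  by (auto simp: graded_def slmat_def homog_def Emat_def)

lemma slmat_Emat: "i < dimN m n \<Longrightarrow> j < dimN m n \<Longrightarrow> i \<noteq> j \<Longrightarrow> slmat m n (Emat i j)"
  using graded_Emat unfolding graded_def by blast

lemma homog_diagmat: "homog m False (diagmat h)"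
  by (simp add: homog_def diagmat_def)

lemma sldiag_slmat: "sldiag m n h \<Longrightarrow> slmat m n (diagmat h)"
  by (simp add: sldiag_def)

lemma sldiag_iff: "sldiag m n h \<longleftrightarrow> (\<forall>i\<ge>dimN m n. h i = 0) \<and> (\<Sum>i<dimN m n. sgi m i * h i) = 0"
  by (auto simp: sldiag_def slmat_def is_mat_def diagmat_def str_eq_sum)

text \<open>Up to sign, \<open>cor i j\<close> and \<open>ocor i j\<close> are the coroots of the even and odd root \<open>\<epsilon>\<^sub>i - \<epsilon>\<^sub>j\<close>.\<close>

definition cor :: "nat \<Rightarrow> nat \<Rightarrow> nat \<Rightarrow> complex" where
  "cor i j = (\<lambda>x. (if x = i then 1 else 0) - (if x = j then 1 else 0))"

definition ocor :: "nat \<Rightarrow> nat \<Rightarrow> nat \<Rightarrow> complex" where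
  "ocor i j = (\<lambda>x. (if x = i then 1 else 0) + (if x = j then 1 else 0))"

lemma sum_sgi_delta:
  "i < dimN m n \<Longrightarrow> (\<Sum>x<dimN m n. sgi m x * (if x = i then 1 else 0)) = sgi m i"
  by (simp add: mult_if_delta if_distrib cong: if_cong)

lemma sldiag_cor:
  assumes "i < dimN m n" "j < dimN m n" "odd_idx m i = odd_idx m j"
  shows "sldiag m n (cor i j)"
  using assms sum_sgi_delta[of i m n] sum_sgi_delta[of j m n]
  by (auto simp: sldiag_iff cor_def sgi_def right_diff_distrib sum_subtractf)

lemma sldiag_ocor:
  assumes "i < dimN m n" "j < dimN m n" "odd_idx m i \<noteq> odd_idx m j"
  shows "sldiag m n (ocor i j)"
  using assms sum_sgi_delta[of i m n] sum_sgi_delta[of j m n]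
  by (auto simp: sldiag_iff ocor_def sgi_def distrib_left sum.distrib)

lemma dimN_gt: "i \<le> m \<Longrightarrow> i < dimN m n" "j \<le> n \<Longrightarrow> m + j < dimN m n"
  by (simp_all add: dimN_def)

lemma sum_sgi_nonzero:
  assumes "n \<noteq> m + 1"
  shows "(\<Sum>i<dimN m n. sgi m i) \<noteq> 0"
proof -
  have "(\<Sum>i<dimN m n. sgi m i) = str m n (\<lambda>_ _. 1)" by (simp add: str_eq_sum)
  also have "\<dots> = of_nat (m + 1) - of_nat n" by (simp add: str_def dimN_def)
  finally show ?thesis using assms by (metis eq_iff_diff_eq_0 of_nat_eq_iff)
qed

text \<open>A constant \<open>c\<close> can make the diagonal supertraceless because the identity
  matrix has supertrace \<open>m + 1 - n\<close>, which is nonzero here. Commutators with the result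
  measure the height.\<close>

lemma sldiag_grading:
  assumes "n \<noteq> m + 1"
  obtains c :: complex where "sldiag m n (\<lambda>i. if i < dimN m n then c - of_nat (\<pi> i) else 0)"
proof
  let ?t = "\<Sum>i<dimN m n. sgi m i"
  define c :: complex where "c = (\<Sum>i<dimN m n. sgi m i * of_nat (\<pi> i)) / ?t"
  have "?t \<noteq> 0" using assms by (rule sum_sgi_nonzero)
  then have "(\<Sum>i<dimN m n. sgi m i * c) = (\<Sum>i<dimN m n. sgi m i * of_nat (\<pi> i))"
    unfolding sum_distrib_right[symmetric] c_def by simp
  then show "sldiag m n (\<lambda>i. if i < dimN m n then c - of_nat (\<pi> i) else 0)"
    unfolding sldiag_iff by (simp add: right_diff_distrib sum_subtractf)
qed

section \<open>Representations of the affine superalgebra\<close>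

locale affine_module = complex_space smul
  for smul :: "complex \<Rightarrow> 'v::ab_group_add \<Rightarrow> 'v" +
  fixes m n :: nat and X :: "int \<Rightarrow> cmat \<Rightarrow> 'v \<Rightarrow> 'v" and K D :: "'v \<Rightarrow> 'v"
  assumes rep: "affine_rep m n smul X K D"
begin

abbreviation "N \<equiv> dimN m n"
abbreviation "sl \<equiv> slmat m n"
abbreviation "gr \<equiv> graded m n"

lemma lin_X: "sl a \<Longrightarrow> lin (X r a)"
  using rep by (simp add: affine_rep_def)

lemma lin_K: "lin K" and lin_D: "lin D"
  using rep by (simp_all add: affine_rep_def)

lemma X_comb: "sl a \<Longrightarrow> sl b \<Longrightarrow> X r (\<lambda>i j. c * a i j + b i j) u = smul c (X r a u) + X r b u"
  using rep by (simp add: affine_rep_def)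

lemma X_bracket:
  assumes "sl a" "sl b" "homog m pa a" "homog m pb b"
  shows "X r a (X s b u) = smul (if pa \<and> pb then -1 else 1) (X s b (X r a u))
      + X (r + s) (sbr m n pa pb a b) u
      + smul (if r + s = 0 then of_int r * str m n (matmul m n a b) else 0) (K u)"
proof -
  have "\<forall>r s a b pa pb v. sl a \<and> sl b \<and> homog m pa a \<and> homog m pb b \<longrightarrow>
        X r a (X s b v) - smul (if pa \<and> pb then -1 else 1) (X s b (X r a v))
          = X (r + s) (sbr m n pa pb a b) v
            + smul (if r + s = 0 then of_int r * str m n (matmul m n a b) else 0) (K v)"
    using rep unfolding affine_rep_def by (elim conjE)
  then have "X r a (X s b u) - smul (if pa \<and> pb then -1 else 1) (X s b (X r a u))
          = X (r + s) (sbr m n pa pb a b) u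
            + smul (if r + s = 0 then of_int r * str m n (matmul m n a b) else 0) (K u)"
    using assms by blast
  then show ?thesis unfolding diff_eq_eq by (simp only: ac_simps)
qed

lemma K_X: "sl a \<Longrightarrow> K (X r a u) = X r a (K u)"
  using rep by (simp add: affine_rep_def)

lemma K_D: "K (D u) = D (K u)"
  using rep by (simp add: affine_rep_def)

lemma D_X:
  assumes "sl a"
  shows "D (X r a u) = X r a (D u) + smul (of_int r) (X r a u)"
proof -
  have "D (X r a u) - X r a (D u) = smul (of_int r) (X r a u)"
    using rep assms by (simp add: affine_rep_def)
  then show ?thesis unfolding diff_eq_eq by (simp only: add.commute)
qed

lemma X_zero [simp]: "X r (\<lambda>_ _. 0) u = 0"
  using X_comb[OF slmat_zero slmat_zero, of r 1 u] by simp

lemma X_add: "sl a \<Longrightarrow> sl b \<Longrightarrow> X r (\<lambda>i j. a i j + b i j) u = X r a u + X r b u"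
  using X_comb[of a b r 1 u] by simp

lemma X_scale: "sl a \<Longrightarrow> X r (\<lambda>i j. c * a i j) u = smul c (X r a u)"
  using X_comb[OF _ slmat_zero, of a r c u] by simp

text \<open>The defining relation is stated for homogeneous pairs. For even \<open>f\<close> it is
  additive in \<open>a\<close>, so splitting \<open>a\<close> by parity (\<open>\<pi>\<close>
  constant) extends it to all \<open>a\<close>.\<close>

lemma X_com:
  assumes f: "sl f" "homog m False f" and a: "sl a"
  shows "X r f (X s a u) = X s a (X r f u) + X (r + s) (com m n f a) u
      + smul (if r + s = 0 then of_int r * str m n (matmul m n f a) else 0) (K u)"
  using a
proof (rule graded_decompose[where \<pi> = "\<lambda>_. 0"])
  fix p d b assume "graded m n (\<lambda>_. 0) p d b"
  then have "sl b" "homog m p b" by (auto simp: graded_def)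
  then show "X r f (X s b u) = X s b (X r f u) + X (r + s) (com m n f b) u
      + smul (if r + s = 0 then of_int r * str m n (matmul m n f b) else 0) (K u)"
    using X_bracket[of f b False p r s u] f by (simp add: sbr_False)
next
  fix b c assume b: "sl b" and c: "sl c"
    and IH: "X r f (X s b u) = X s b (X r f u) + X (r + s) (com m n f b) u
      + smul (if r + s = 0 then of_int r * str m n (matmul m n f b) else 0) (K u)"
    "X r f (X s c u) = X s c (X r f u) + X (r + s) (com m n f c) u
      + smul (if r + s = 0 then of_int r * str m n (matmul m n f c) else 0) (K u)"
  have "matmul m n f (\<lambda>i j. b i j + c i j) = (\<lambda>i j. 1 * matmul m n f b i j + matmul m n f c i j)"
    by (simp add: matmul_def sum.distrib algebra_simps)
  moreover have "com m n f (\<lambda>i j. b i j + c i j) = (\<lambda>i j. com m n f b i j + com m n f c i j)"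
    by (simp add: com_def matmul_def sum.distrib algebra_simps)
  ultimately show "X r f (X s (\<lambda>i j. b i j + c i j) u) = X s (\<lambda>i j. b i j + c i j) (X r f u)
      + X (r + s) (com m n f (\<lambda>i j. b i j + c i j)) u
      + smul (if r + s = 0 then of_int r * str m n (matmul m n f (\<lambda>i j. b i j + c i j)) else 0) (K u)"
    using b c IH f str_comb[of m n 1]
    by (cases "r + s = 0")
      (simp_all add: X_add slmat_com lin_simps[OF lin_X] scale_left_distrib distrib_left ac_simps)
qed

lemma X_diagmat_com:
  assumes "sldiag m n h" "sl a"
  shows "X 0 (diagmat h) (X r a u) = X r a (X 0 (diagmat h) u) + X r (\<lambda>x y. (h x - h y) * a x y) u"
  using X_com[OF sldiag_slmat[OF assms(1)] homog_diagmat assms(2), of 0 r u] assms(2)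
  by (simp add: com_diagmat slmat_def)

lemma X_diagmat_Emat:
  assumes "sldiag m n h" "i < N" "j < N" "i \<noteq> j"
  shows "X 0 (diagmat h) (X r (Emat i j) u)
    = X r (Emat i j) (X 0 (diagmat h) u) + smul (h i - h j) (X r (Emat i j) u)"
proof -
  have "(\<lambda>x y. (h x - h y) * Emat i j x y) = (\<lambda>x y. (h i - h j) * Emat i j x y)"
    by (auto simp: Emat_def fun_eq_iff)
  then show ?thesis
    using X_diagmat_com[OF assms(1) slmat_Emat[OF assms(2-4)], of r u]
    by (simp add: X_scale[OF slmat_Emat[OF assms(2-4)]])
qed

text \<open>The bracket of opposite root vectors is the coroot up to sign, a sum of diagonal units
  for odd roots; the cocycle adds \<open>r\<close> times the supertrace of
  \<open>Emat i i\<close>.\<close>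

lemma X_Emat_pair:
  assumes "i < N" "j < N" "i \<noteq> j"
  shows "X r (Emat i j) (X (-r) (Emat j i) u) =
    smul (if odd_idx m i \<noteq> odd_idx m j then -1 else 1) (X (-r) (Emat j i) (X r (Emat i j) u))
    + X 0 (diagmat (if odd_idx m i \<noteq> odd_idx m j then ocor i j else cor i j)) u
    + smul (of_int r * sgi m i) (K u)"
proof -
  let ?p = "odd_idx m i \<noteq> odd_idx m j"
  have 1: "matmul m n (Emat i j) (Emat j i) = Emat i i" "matmul m n (Emat j i) (Emat i j) = Emat j j"
    using assms by (simp_all add: matmul_Emat_right) (auto simp: Emat_def fun_eq_iff)
  have 2: "sbr m n ?p ?p (Emat i j) (Emat j i) = diagmat (if ?p then ocor i j else cor i j)"
    unfolding sbr_def 1 by (auto simp: fun_eq_iff Emat_def diagmat_def ocor_def cor_def)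
  have "homog m ?p (Emat i j)" "homog m ?p (Emat j i)"
    by (auto simp: homog_def Emat_def)
  from X_bracket[OF slmat_Emat slmat_Emat this, of r "-r" u] show ?thesis
    using assms unfolding 1 2 by (simp add: str_Emat cong: if_cong)
qed

text \<open>The sl(2)-triple of the real root
  \<open>\<epsilon>\<^sub>i - \<epsilon>\<^sub>j + r \<delta>\<close>, whose coroot acts as
  \<open>h\<close>.\<close>

lemma X_Emat_sl2:
  fixes r :: int
  assumes "i \<le> m" "j \<le> m" "i \<noteq> j"
  defines "h \<equiv> (\<lambda>u. X 0 (diagmat (cor i j)) u + smul (of_int r) (K u))"
  shows "lin h"
    and "X r (Emat i j) (X (-r) (Emat j i) u) = X (-r) (Emat j i) (X r (Emat i j) u) + h u"
    and "h (X (-r) (Emat j i) u) = X (-r) (Emat j i) (h u) - smul 2 (X (-r) (Emat j i) u)"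
proof -
  have ij: "i < N" "j < N" using assms by (auto simp: dimN_gt)
  have ev: "\<not> odd_idx m i" "\<not> odd_idx m j" using assms by (auto simp: odd_idx_def)
  have c: "sldiag m n (cor i j)" using ij ev by (simp add: sldiag_cor)
  have sE: "sl (Emat j i)" using ij assms(3) by (simp add: slmat_Emat)
  show "lin h"
    unfolding Vector_Spaces.linear_def module_hom_iff h_def
    using lin_simps[OF lin_X[OF sldiag_slmat[OF c]]] lin_simps[OF lin_K]
    by (auto simp: vector_space_axioms module_axioms scale_right_distrib mult.commute)
  show "X r (Emat i j) (X (-r) (Emat j i) u) = X (-r) (Emat j i) (X r (Emat i j) u) + h u"
    using X_Emat_pair[OF ij assms(3), of r u] ev by (simp add: h_def sgi_def add.assoc)
  show "h (X (-r) (Emat j i) u) = X (-r) (Emat j i) (h u) - smul 2 (X (-r) (Emat j i) u)"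
    using X_diagmat_Emat[OF c ij(2,1), of "-r" u] assms(3)
    by (simp add: h_def K_X[OF sE] lin_simps[OF lin_X[OF sE]] cor_def)
qed

end

locale hw_module = affine_module smul m n X K D
  for smul :: "complex \<Rightarrow> 'v::ab_group_add \<Rightarrow> 'v" and m n X K D +
  fixes lam :: "(nat \<Rightarrow> complex) \<Rightarrow> complex" and k ld :: complex and v
  assumes irr: "irreducible_rep m n smul X K D"
    and hw: "hw_vector m n smul X K D lam k ld v"
    and nm: "n \<le> m"
begin

lemma v_diag: "sldiag m n h \<Longrightarrow> X 0 (diagmat h) v = smul (lam h) v"
  using hw unfolding hw_vector_def by auto

lemma v_nz: "v \<noteq> 0" and v_K: "K v = smul k v" and v_D: "D v = smul ld v"
  using hw unfolding hw_vector_def by auto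

lemma submodule_UNIV:
  assumes "submodule m n smul X K D W" "u \<in> W" "u \<noteq> 0"
  shows "W = UNIV"
proof -
  have "W = {0} \<or> W = UNIV" using irr assms(1) unfolding irreducible_rep_def by blast
  then show ?thesis using assms by auto
qed

text \<open>Schur's argument: \<open>K\<close> is central, so its eigenspace containing
  \<open>v\<close> is a submodule.\<close>

lemma K_scalar: "K u = smul k u"
proof -
  have "submodule m n smul X K D {u. K u = smul k u}"
    unfolding submodule_def
    by (auto simp: lin_simps[OF lin_K] scale_right_distrib K_X K_D lin_simps[OF lin_X]
        lin_simps[OF lin_D] scale_left_commute)
  from submodule_UNIV[OF this _ v_nz] v_K show ?thesis by auto
qed

text \<open>\<open>lam\<close> is a bare function; on \<open>sldiag\<close> it is linear because it
  lists eigenvalues of a linear action on \<open>v \<noteq> 0\<close>.\<close>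

lemma lam_comb:
  assumes "sldiag m n h" "sldiag m n h'"
  shows "lam (\<lambda>x. c * h x + h' x) = c * lam h + lam h'"
proof -
  have "diagmat (\<lambda>x. c * h x + h' x) = (\<lambda>i j. c * diagmat h i j + diagmat h' i j)"
    by (auto simp: diagmat_def fun_eq_iff)
  moreover from this have "sldiag m n (\<lambda>x. c * h x + h' x)"
    using slmat_comb[of m n "diagmat h" "diagmat h'" c] assms by (simp add: sldiag_def)
  ultimately have "smul (lam (\<lambda>x. c * h x + h' x)) v
      = X 0 (\<lambda>i j. c * diagmat h i j + diagmat h' i j) v"
    using v_diag by fastforce
  also have "\<dots> = smul (c * lam h + lam h') v"
    unfolding X_comb[OF sldiag_slmat sldiag_slmat, OF assms] v_diag[OF assms(1)] v_diag[OF assms(2)]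
    by (simp add: scale_left_distrib)
  finally have "smul (lam (\<lambda>x. c * h x + h' x)) v = smul (c * lam h + lam h') v" .
  then show ?thesis using v_nz by (simp add: scale_cancel_right)
qed

text \<open>The vectors on which the root vector is nilpotent form a submodule containing
  \<open>v\<close>, hence all of the module. Stability under \<open>X s a\<close> is obtained from
  the third iterated commutator backwards.\<close>

lemma nilpotent_Emat:
  assumes ij: "i \<le> m" "j \<le> m" "i \<noteq> j" and nil: "v \<in> nil_set (X r (Emat i j))"
  shows "loc_nilp (X r (Emat i j))"
proof -
  let ?f = "X r (Emat i j)"
  let ?c = "com m n (Emat i j)"
  have N: "i < N" "j < N" using ij by (auto simp: dimN_gt)
  have ev: "homog m False (Emat i j)" using ij by (auto simp: homog_def Emat_def odd_idx_def)
  have sf: "sl (Emat i j)" using N ij by (simp add: slmat_Emat)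
  have lf: "lin ?f" using sf by (rule lin_X)
  have step: "X s a u \<in> nil_set ?f"
    if a: "sl a" and C: "\<And>w. w \<in> nil_set ?f \<Longrightarrow> X (r + s) (?c a) w \<in> nil_set ?f"
      and u: "u \<in> nil_set ?f" for s a u
  proof (rule nil_set_preserved[OF lf _ _ _ u])
    show "?f (X s a w) = X s a (?f w) + (X (r + s) (?c a) w
      + smul (if r + s = 0 then of_int r * str m n (matmul m n (Emat i j) a) else 0) (K w))" for w
      using X_com[OF sf ev a] by (simp add: add.assoc)
    show "X s a 0 = 0" using lin_simps(3)[OF lin_X[OF a]] .
  next
    fix w assume "w \<in> nil_set ?f"
    then show "X (r + s) (?c a) w
      + smul (if r + s = 0 then of_int r * str m n (matmul m n (Emat i j) a) else 0) (K w)
      \<in> nil_set ?f"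
      unfolding K_scalar by (intro nil_set_add lf nil_set_smul C)
  qed
  have X: "X s a u \<in> nil_set ?f" if a: "sl a" and u: "u \<in> nil_set ?f" for s a u
  proof -
    \<comment> \<open>Each term of the triple commutator contains the square of
      \<open>Emat i j\<close>, which is 0.\<close>
    have "?c (?c (?c a)) = (\<lambda>_ _. 0)"
      using N ij by (auto simp: com_def matmul_Emat_left matmul_Emat_right fun_eq_iff)
    then have 0: "X s (?c (?c (?c a))) w \<in> nil_set ?f" for s w
      by (simp add: nil_set_0)
    have sc: "sl (?c a)" "sl (?c (?c a))" by (simp_all add: slmat_com sf ev a)
    have 1: "X s (?c (?c a)) w \<in> nil_set ?f" if "w \<in> nil_set ?f" for s w
      by (rule step[OF sc(2) 0 that])
    have 2: "X s (?c a) w \<in> nil_set ?f" if "w \<in> nil_set ?f" for s w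
      by (rule step[OF sc(1) 1 that])
    show ?thesis by (rule step[OF a 2 u])
  qed
  have "submodule m n smul X K D (nil_set ?f)"
    unfolding submodule_def
  proof (intro conjI ballI allI impI)
    fix u assume u: "u \<in> nil_set ?f"
    show "K u \<in> nil_set ?f" unfolding K_scalar using lf u by (rule nil_set_smul)
    show "D u \<in> nil_set ?f"
    proof (rule nil_set_preserved[OF lf _ _ _ u])
      show "?f (D w) = D (?f w) + smul (- of_int r) (?f w)" for w
        using D_X[OF sf, of r w] by simp
      show "D 0 = 0" using lin_simps(3)[OF lin_D] .
      show "smul (- of_int r) (?f w) \<in> nil_set ?f" if "w \<in> nil_set ?f" for w
        using that by (intro nil_set_smul lf nil_set_self)
    qed
  qed (auto simp: nil_set_0 nil_set_add[OF lf] nil_set_smul[OF lf] X)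
  from submodule_UNIV[OF this nil v_nz] show ?thesis
    unfolding nil_set_def loc_nilp_def by auto
qed

end

section \<open>Singular vectors\<close>

context hw_module
begin

text \<open>\<open>e\<close> is the total drop of the principal degree \<open>d + r * int N\<close>
  under the elements of nonpositive degree applied to \<open>w\<close>.\<close>

inductive gen :: "(nat \<Rightarrow> nat) \<Rightarrow> 'v \<Rightarrow> nat \<Rightarrow> 'v \<Rightarrow> bool" for \<pi> w where
  gen_base: "gen \<pi> w 0 w"
| gen_step: "gen \<pi> w e u \<Longrightarrow> gr \<pi> p d a \<Longrightarrow> d + r * int N = - int e' \<Longrightarrow> gen \<pi> w (e + e') (X r a u)"

text \<open>If \<open>\<pi>\<close> permutes \<open>{..<N}\<close>, then
  \<open>d + r * int N > 0\<close> means \<open>r > 0\<close>, or \<open>r = 0\<close> and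
  \<open>d > 0\<close>: these are the positive roots of the affine system of
  \<open>\<pi>\<close>.\<close>

definition singular :: "(nat \<Rightarrow> nat) \<Rightarrow> 'v \<Rightarrow> bool" where
  "singular \<pi> w \<longleftrightarrow> (\<forall>r p d a. gr \<pi> p d a \<and> d + r * int N > 0 \<longrightarrow> X r a w = 0)"

lemma lin_span_closed:
  assumes f: "lin f" and S: "\<And>x. x \<in> S \<Longrightarrow> f x \<in> span S" and u: "u \<in> span S"
  shows "f u \<in> span S"
  using u
proof (induction rule: span_induct_alt)
  case base
  then show ?case by (simp add: lin_simps[OF f] span_zero)
next
  case (step c x y)
  then show ?case by (simp add: lin_simps[OF f] span_add span_scale S)
qed

text \<open>A substitute for the triangular decomposition: the span is stable under the whole
  algebra, so it is everything by irreducibility.\<close>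

lemma span_gen_UNIV:
  assumes w: "singular \<pi> w" "w \<noteq> 0" and wD: "D w = smul \<delta> w"
  shows "span {u. \<exists>e. gen \<pi> w e u} = UNIV"
proof -
  let ?S = "{u. \<exists>e. gen \<pi> w e u}"
  have neg: "X r a u \<in> span ?S" if "gr \<pi> p d a" "d + r * int N \<le> 0" "u \<in> span ?S" for r p d a u
  proof (rule lin_span_closed[OF lin_X _ that(3)])
    show "sl a" using that(1) by (simp add: graded_def)
    fix x assume "x \<in> ?S"
    then obtain e where e: "gen \<pi> w e x" by blast
    obtain e' where "d + r * int N = - int e'"
      using nonpos_int_cases[OF \<open>d + r * int N \<le> 0\<close>] by blast
    from gen_step[OF e that(1) this] show "X r a x \<in> span ?S" by (auto intro: span_base)
  qed
  have gX: "X r a u \<in> span ?S" if "gen \<pi> w e u" "gr \<pi> p d a" for e u r p d a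
    using that
  proof (induction arbitrary: r p d a)
    case gen_base
    have "w \<in> span ?S" by (rule span_base) (auto intro: gen.gen_base)
    then show ?case
      using neg[OF gen_base, of r w] w(1) gen_base span_zero
      unfolding singular_def by (cases "d + r * int N > 0") auto
  next
    \<comment> \<open>The new element is moved past \<open>X s b\<close>; it and its bracket with
      \<open>b\<close> then act on the earlier vector \<open>u\<close>, where the induction
      hypothesis covers every degree.\<close>
    case (gen_step e u q c b s e')
    have sl: "sl a" "homog m p a" "sl b" "homog m q b"
      using gen_step by (auto simp: graded_def)
    have "X s b (X r a u) \<in> span ?S"
      using gen_step.hyps(3) gen_step.IH[OF gen_step.prems]
      by (intro neg[OF gen_step.hyps(2)]) auto
    moreover have "X (r + s) (sbr m n p q a b) u \<in> span ?S"
      by (rule gen_step.IH[OF graded_sbr[OF gen_step.prems gen_step.hyps(2)]])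
    moreover have "u \<in> span ?S" using gen_step.hyps(1) by (auto intro: span_base)
    ultimately show ?case
      unfolding X_bracket[OF sl(1,3,2,4)] K_scalar by (intro span_add span_scale)
  qed
  have sX: "X r a u \<in> span ?S" if "sl a" "u \<in> span ?S" for r a u
    using that(1)
  proof (rule graded_decompose[where \<pi> = \<pi>])
    fix p d b assume b: "gr \<pi> p d b"
    show "X r b u \<in> span ?S"
      using b by (intro lin_span_closed[OF lin_X _ that(2)]) (auto simp: graded_def intro: gX[OF _ b])
  qed (simp add: X_add span_add)
  have gD: "\<exists>c. D u = smul c u" if "gen \<pi> w e u" for e u
    using that
  proof induction
    case gen_base
    show ?case using wD by blast
  next
    case (gen_step e u p d a r e')
    then obtain c where "D u = smul c u" by blast
    moreover have "sl a" using gen_step by (simp add: graded_def)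
    ultimately have "D (X r a u) = smul (c + of_int r) (X r a u)"
      by (simp add: D_X lin_simps[OF lin_X] scale_left_distrib)
    then show ?case by blast
  qed
  have sD: "D u \<in> span ?S" if "u \<in> span ?S" for u
  proof (rule lin_span_closed[OF lin_D _ that])
    fix x assume "x \<in> ?S"
    moreover from this obtain c where "D x = smul c x" using gD by blast
    ultimately show "D x \<in> span ?S" by (simp add: span_scale span_base)
  qed
  have "submodule m n smul X K D (span ?S)"
    unfolding submodule_def using sX sD
    by (auto simp: span_zero span_add span_scale K_scalar)
  moreover have "w \<in> span ?S" by (rule span_base) (auto intro: gen.gen_base)
  ultimately show ?thesis using submodule_UNIV w(2) by blast
qed

section \<open>The principal grading\<close>

definition hdeg :: "(nat \<Rightarrow> complex) \<Rightarrow> 'v \<Rightarrow> 'v" where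
  "hdeg g u = smul (of_nat N) (D u) + X 0 (diagmat g) u"

text \<open>\<open>hdeg g\<close> measures the principal degree: a matrix unit \<open>E i j t^r\<close> shifts its
  eigenvalues by \<open>\<pi> j - \<pi> i + r N\<close>.\<close>

definition grading_diag :: "(nat \<Rightarrow> nat) \<Rightarrow> (nat \<Rightarrow> complex) \<Rightarrow> bool" where
  "grading_diag \<pi> g \<longleftrightarrow> sldiag m n g \<and>
     (\<forall>i<N. \<forall>j<N. g i - g j = of_int (int (\<pi> j) - int (\<pi> i)))"

lemma grading_diag_exists: "\<exists>g. grading_diag \<pi> g"
proof -
  obtain c where "sldiag m n (\<lambda>i. if i < N then c - of_nat (\<pi> i) else 0)"
    using sldiag_grading[of n m \<pi>] nm by auto
  then have "grading_diag \<pi> (\<lambda>i. if i < N then c - of_nat (\<pi> i) else 0)"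
    by (simp add: grading_diag_def)
  then show ?thesis by blast
qed

lemma hdeg_X:
  assumes g: "grading_diag \<pi> g" and a: "gr \<pi> p d a"
  shows "hdeg g (X r a u) = X r a (hdeg g u) + smul (of_int (d + r * int N)) (X r a u)"
proof -
  have sl: "sl a" "is_mat m n a" using a by (auto simp: graded_def slmat_def)
  have "(g x - g y) * a x y = of_int d * a x y" for x y
  proof (cases "a x y = 0")
    case False
    then have "x < N" "y < N" "int (\<pi> y) - int (\<pi> x) = d"
      using sl(2) a unfolding is_mat_def graded_def by (auto simp: not_le[symmetric])
    then show ?thesis using g unfolding grading_diag_def by metis
  qed simp
  then have "(\<lambda>x y. (g x - g y) * a x y) = (\<lambda>x y. of_int d * a x y)" by blast
  then have "X 0 (diagmat g) (X r a u) = X r a (X 0 (diagmat g) u) + smul (of_int d) (X r a u)"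
    using X_diagmat_com[of g a r u] g sl(1) unfolding grading_diag_def by (simp add: X_scale)
  then show ?thesis
    unfolding hdeg_def D_X[OF sl(1)]
    by (simp add: lin_simps[OF lin_X[OF sl(1)]] scale_right_distrib scale_left_distrib ac_simps)
qed

lemma lin_hdeg:
  assumes "grading_diag \<pi> g"
  shows "hdeg g (u + w) = hdeg g u + hdeg g w" "hdeg g (smul c u) = smul c (hdeg g u)"
  using assms unfolding hdeg_def grading_diag_def
  by (simp_all add: lin_simps[OF lin_D] lin_simps[OF lin_X] sldiag_slmat scale_right_distrib
      ac_simps)

text \<open>The product of the operators \<open>hdeg g - (\<mu> - j)\<close> for
  \<open>j < M\<close>. It kills eigenvectors of degree \<open>\<mu> - e\<close> with
  \<open>e < M\<close>, and so compares degrees without an eigenspace decomposition.\<close>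

fun hprod :: "(nat \<Rightarrow> complex) \<Rightarrow> complex \<Rightarrow> nat \<Rightarrow> 'v \<Rightarrow> 'v" where
  "hprod g \<mu> 0 u = u"
| "hprod g \<mu> (Suc M) u = hdeg g (hprod g \<mu> M u) - smul (\<mu> - of_nat M) (hprod g \<mu> M u)"

lemma hprod_eigen:
  assumes g: "grading_diag \<pi> g" and u: "hdeg g u = smul c u"
  shows "hprod g \<mu> M u = smul (\<Prod>j<M. c - \<mu> + of_nat j) u"
proof (induction M)
  case (Suc M)
  let ?q = "\<Prod>j<M. c - \<mu> + of_nat j"
  have "hprod g \<mu> (Suc M) u = smul (?q * c) u - smul ((\<mu> - of_nat M) * ?q) u"
    by (simp add: Suc.IH lin_hdeg[OF g] u)
  also have "\<dots> = smul (?q * (c - \<mu> + of_nat M)) u"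
    by (simp only: scale_left_diff_distrib[symmetric]) (simp add: algebra_simps)
  finally show ?case by (simp add: mult.commute)
qed simp

lemma lin_hprod:
  assumes g: "grading_diag \<pi> g"
  shows "hprod g \<mu> M (u + w) = hprod g \<mu> M u + hprod g \<mu> M w"
    "hprod g \<mu> M (smul c u) = smul c (hprod g \<mu> M u)"
  by (induction M)
    (simp_all add: lin_hdeg[OF g] scale_right_distrib scale_right_diff_distrib ac_simps algebra_simps)

text \<open>A singular vector generates its submodule by operators of nonpositive degree, so if its
  degree is below that of \<open>v\<close>, then so are the degrees occurring in that submodule.\<close>

lemma singular_lower_zero:
  assumes g: "grading_diag \<pi> g"
    and w: "singular \<pi> w" and wD: "D w = smul \<delta> w" and wh: "hdeg g w = smul \<mu> w"
    and vh: "hdeg g v = smul (\<mu> + of_nat (Suc q)) v"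
  shows "w = 0"
proof (rule ccontr)
  assume w0: "w \<noteq> 0"
  have e: "hdeg g u = smul (\<mu> - of_nat e) u" if "gen \<pi> w e u" for e u
    using that
  proof induction
    case gen_base
    show ?case using wh by simp
  next
    case (gen_step e u p d a r e')
    have sa: "sl a" using gen_step by (simp add: graded_def)
    have "hdeg g (X r a u) = smul (\<mu> - of_nat e) (X r a u) + smul (of_int (- int e')) (X r a u)"
      unfolding hdeg_X[OF g gen_step.hyps(2)] gen_step.IH gen_step.hyps(3) lin_simps[OF lin_X[OF sa]] ..
    then show ?case by (simp only: scale_left_distrib[symmetric]) (simp add: algebra_simps)
  qed
  have "\<exists>M0. \<forall>M\<ge>M0. hprod g \<mu> M u = 0" if "u \<in> span {u. \<exists>e. gen \<pi> w e u}" for u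
    using that
  proof (induction rule: span_induct_alt)
    case base
    have "hprod g \<mu> M 0 = 0" for M using lin_hprod(2)[OF g, of \<mu> M 0] by simp
    then show ?case by blast
  next
    case (step c x y)
    then obtain e where "gen \<pi> w e x" by blast
    then have xe: "hprod g \<mu> M x = smul (\<Prod>j<M. - of_nat e + of_nat j) x" for M
      using hprod_eigen[OF g e] by simp
    have "hprod g \<mu> M x = 0" if "M \<ge> Suc e" for M
    proof -
      have "(\<Prod>j<M. - of_nat e + of_nat j :: complex) = 0"
        using that by (intro prod_zero) (auto intro: bexI[of _ e])
      then show ?thesis unfolding xe by simp
    qed
    moreover obtain M0 where "\<forall>M\<ge>M0. hprod g \<mu> M y = 0" using step by blast
    ultimately have "\<forall>M\<ge>max M0 (Suc e). hprod g \<mu> M (smul c x + y) = 0"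
      by (simp add: lin_hprod[OF g])
    then show ?case by blast
  qed
  then obtain M where M: "hprod g \<mu> M v = 0"
    using span_gen_UNIV[OF w w0 wD] by (metis UNIV_I order_refl)
  \<comment> \<open>On \<open>v\<close>, which lies above degree \<open>\<mu>\<close>, all factors
    are positive integers.\<close>
  have "hprod g \<mu> M v = smul (\<Prod>j<M. of_nat (Suc q + j)) v"
    unfolding hprod_eigen[OF g vh] by (simp add: algebra_simps)
  then have "(\<Prod>j<M. of_nat (Suc q + j) :: complex) = 0" using M v_nz by simp
  then show False unfolding prod_zero_iff[OF finite_lessThan] of_nat_eq_0_iff by auto
qed

text \<open>Weakens \<open>singular\<close> by exempting the one root vector \<open>Emat i j\<close>
  at level \<open>r0\<close>; unlike \<open>singular\<close>, it persists along the string of a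
  simple root.\<close>

definition killed :: "(nat \<Rightarrow> nat) \<Rightarrow> nat \<Rightarrow> nat \<Rightarrow> int \<Rightarrow> 'v \<Rightarrow> bool" where
  "killed \<pi> i j r0 u \<longleftrightarrow>
     (\<forall>r p d a. gr \<pi> p d a \<and> d + r * int N > 0 \<and> (r = r0 \<longrightarrow> a i j = 0) \<longrightarrow> X r a u = 0)"

text \<open>In the affine root system \<open>\<delta>\<close> has height \<open>N\<close>; the simple roots are those of height 1.\<close>

definition simple_root :: "(nat \<Rightarrow> nat) \<Rightarrow> nat \<Rightarrow> nat \<Rightarrow> int \<Rightarrow> bool" where
  "simple_root \<pi> i j r \<longleftrightarrow> inj_on \<pi> {..<N} \<and> (\<forall>x<N. \<pi> x < N) \<and> i < N \<and> j < N \<and> i \<noteq> j \<and>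
     int (\<pi> j) - int (\<pi> i) + r * int N = 1"

text \<open>The positive root vectors other than that of a simple root span an ideal of the
  positive part, which is moreover normalized by the opposite simple root vector.\<close>

lemma killed_step:
  assumes sr: "simple_root \<pi> i j r0" and u: "killed \<pi> i j r0 u"
  shows "killed \<pi> i j r0 (X (- r0) (Emat j i) u)"
  unfolding killed_def
proof (intro allI impI, elim conjE)
  fix r p d a
  assume a: "gr \<pi> p d a" and pos: "d + r * int N > 0" and aij: "r = r0 \<longrightarrow> a i j = 0"
  let ?f = "Emat j i" and ?q = "odd_idx m j \<noteq> odd_idx m i"
  have ij: "i < N" "j < N" "i \<noteq> j" and deg: "int (\<pi> j) - int (\<pi> i) + r0 * int N = 1"
    and inj: "inj_on \<pi> {..<N}" and lt: "\<And>x. x < N \<Longrightarrow> \<pi> x < N"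
    using sr by (auto simp: simple_root_def)
  have f: "gr \<pi> ?q (int (\<pi> i) - int (\<pi> j)) ?f" using ij by (intro graded_Emat) auto
  have sl: "sl a" "homog m p a" "is_mat m n a" "sl ?f" "homog m ?q ?f"
    using a f by (auto simp: graded_def slmat_def)
  have Xa: "X r a u = 0" using u a pos aij unfolding killed_def by blast
  have br: "sbr m n p ?q a ?f = (\<lambda>x y. (if y = i then a x j else 0)
      - (if p \<and> ?q then -1 else 1) * (if x = j then a i y else 0))"
    using ij by (simp add: sbr_def matmul_Emat_left matmul_Emat_right)
  \<comment> \<open>The only possible diagonal entry is \<open>a i j\<close>, so no central term
    arises.\<close>
  have "r = r0 \<Longrightarrow> matmul m n a ?f x x = 0" for x
    using ij aij a deg unfolding matmul_Emat_right[OF ij(2)] by auto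
  then have str0: "r + - r0 = 0 \<Longrightarrow> str m n (matmul m n a ?f) = 0"
    by (simp add: str_eq_sum)
  have "X (r + - r0) (sbr m n p ?q a ?f) u = 0"
  proof (cases "d + r * int N = 1")
    case True
    \<comment> \<open>The bracket has degree 0, where \<open>killed\<close> says nothing. It
      vanishes because an entry of degree 1 in row \<open>i\<close> or column \<open>j\<close> can
      only be the excluded \<open>a i j\<close>.\<close>
    have same: "r = r0 \<and> x = i \<and> y = j"
      if "a x y \<noteq> 0" "x = i \<or> y = j" for x y
    proof -
      have xy: "x < N" "y < N"
        using that(1) sl(3) unfolding is_mat_def by (meson not_le)+
      have d: "int (\<pi> y) - int (\<pi> x) + r * int N = 1"
        using a that(1) True unfolding graded_def by auto
      have bounds: "int (\<pi> x) < int N" "int (\<pi> y) < int N" "int (\<pi> i) < int N" "int (\<pi> j) < int N"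
        using lt xy ij by auto
      have "\<bar>(r - r0) * int N\<bar> < int N"
        using that(2) d deg bounds by (auto simp: left_diff_distrib)
      then have "\<bar>r - r0\<bar> * int N < 1 * int N" by (simp only: abs_mult abs_of_nat mult_1)
      then have r: "r = r0" unfolding mult_less_cancel_right by simp
      then have "\<pi> x = \<pi> i \<and> \<pi> y = \<pi> j" using that(2) d deg by auto
      then show ?thesis using r inj xy ij by (auto dest: inj_onD)
    qed
    then have "a x j = 0" "a i y = 0" for x y using aij by blast+
    then have "sbr m n p ?q a ?f = (\<lambda>_ _. 0)" unfolding br by (simp add: fun_eq_iff)
    then show ?thesis by simp
  next
    case False
    have "sbr m n p ?q a ?f i j = 0" unfolding br using ij(3) by auto
    moreover have "d + (int (\<pi> i) - int (\<pi> j)) + (r + - r0) * int N > 0"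
      using False pos deg by (simp add: algebra_simps)
    ultimately show ?thesis
      using u graded_sbr[OF a f] unfolding killed_def by blast
  qed
  then show "X r a (X (- r0) ?f u) = 0"
    unfolding X_bracket[OF sl(1,4,2,5)] using Xa str0
    by (simp add: lin_simps[OF lin_X[OF sl(4)]])
qed

lemma killed_singular:
  assumes sr: "simple_root \<pi> i j r0" and u: "killed \<pi> i j r0 u" and e: "X r0 (Emat i j) u = 0"
  shows "singular \<pi> u"
  unfolding singular_def
proof (intro allI impI, elim conjE)
  fix r p d a
  assume a: "gr \<pi> p d a" and pos: "d + r * int N > 0"
  have ij: "i < N" "j < N" "i \<noteq> j" using sr by (auto simp: simple_root_def)
  show "X r a u = 0"
  proof (cases "r = r0 \<and> a i j \<noteq> 0")
    case False
    then show ?thesis using u a pos unfolding killed_def by blast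
  next
    case True
    \<comment> \<open>Removing the component along the simple root vector brings \<open>a\<close>
      within reach of \<open>killed\<close>.\<close>
    let ?b = "\<lambda>x y. (- a i j) * Emat i j x y + a x y"
    have p: "(odd_idx m i \<noteq> odd_idx m j) = p" "int (\<pi> j) - int (\<pi> i) = d"
      using a True by (auto simp: graded_def homog_def)
    have sE: "sl (Emat i j)" using ij by (rule slmat_Emat)
    have sa: "sl a" using a by (simp add: graded_def)
    have "gr \<pi> p d ?b"
      using a p slmat_comb[OF sE sa, of "- a i j"]
      by (auto simp: graded_def homog_def Emat_def split: if_splits)
    moreover have "?b i j = 0" by (simp add: Emat_def)
    ultimately have "X r ?b u = 0" using u pos unfolding killed_def by blast
    moreover have "X r ?b u = smul (- a i j) (X r (Emat i j) u) + X r a u"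
      by (rule X_comb[OF sE sa])
    ultimately show ?thesis using True e by simp
  qed
qed

lemma singular_killed: "singular \<pi> u \<Longrightarrow> killed \<pi> i j r u"
  unfolding singular_def killed_def by blast

lemma hdeg_v: "grading_diag \<pi> g \<Longrightarrow> hdeg g v = smul (of_nat N * ld + lam g) v"
  by (simp add: hdeg_def v_D v_diag grading_diag_def scale_left_distrib)

text \<open>A string vector killed by the simple root vector is singular, and its degree is
  \<open>q + 1\<close> below that of \<open>v\<close>.\<close>

lemma simple_string_zero:
  assumes sr: "simple_root \<pi> i j r" and v: "singular \<pi> v"
    and e: "X r (Emat i j) ((X (-r) (Emat j i) ^^ Suc q) v) = 0"
  shows "(X (-r) (Emat j i) ^^ Suc q) v = 0"
proof -
  let ?f = "X (-r) (Emat j i)"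
  have ij: "i < N" "j < N" "i \<noteq> j" and deg: "int (\<pi> j) - int (\<pi> i) + r * int N = 1"
    using sr by (auto simp: simple_root_def)
  have gf: "gr \<pi> (odd_idx m j \<noteq> odd_idx m i) (int (\<pi> i) - int (\<pi> j)) (Emat j i)"
    using ij by (intro graded_Emat) auto
  then have sf: "sl (Emat j i)" by (simp add: graded_def)
  have lf: "lin ?f" using sf by (rule lin_X)
  obtain g where g: "grading_diag \<pi> g" using grading_diag_exists by blast
  let ?c = "of_nat N * ld + lam g"
  have deg': "int (\<pi> i) - int (\<pi> j) + - r * int N = - 1" using deg by simp
  have it: "killed \<pi> i j r ((?f ^^ t) v) \<and> hdeg g ((?f ^^ t) v) = smul (?c - of_nat t) ((?f ^^ t) v)
      \<and> D ((?f ^^ t) v) = smul (ld + of_nat t * of_int (-r)) ((?f ^^ t) v)" for t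
  proof (induction t)
    case 0
    then show ?case using singular_killed[OF v] hdeg_v[OF g] v_D by simp
  next
    case (Suc t)
    have "hdeg g (?f ((?f ^^ t) v)) = smul (?c - of_nat t) (?f ((?f ^^ t) v)) + smul (-1) (?f ((?f ^^ t) v))"
      unfolding hdeg_X[OF g gf] deg' using Suc.IH by (simp add: lin_simps[OF lf])
    then have 1: "hdeg g (?f ((?f ^^ t) v)) = smul (?c - of_nat (Suc t)) (?f ((?f ^^ t) v))"
      by (simp only: scale_left_distrib[symmetric]) (simp add: algebra_simps)
    have "D (?f ((?f ^^ t) v)) = smul (ld + of_nat t * of_int (-r)) (?f ((?f ^^ t) v))
        + smul (of_int (-r)) (?f ((?f ^^ t) v))"
      unfolding D_X[OF sf] using Suc.IH by (simp only: lin_simps[OF lf])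
    then have "D (?f ((?f ^^ t) v)) = smul (ld + of_nat (Suc t) * of_int (-r)) (?f ((?f ^^ t) v))"
      by (simp only: scale_left_distrib[symmetric]) (simp add: algebra_simps)
    with 1 show ?case using killed_step[OF sr] Suc.IH by simp
  qed
  let ?w = "(?f ^^ Suc q) v"
  have "killed \<pi> i j r ?w" using it by blast
  from killed_singular[OF sr this e] have "singular \<pi> ?w" .
  moreover have "hdeg g v = smul ((?c - of_nat (Suc q)) + of_nat (Suc q)) v"
    using hdeg_v[OF g] by simp
  ultimately show ?thesis using it[of "Suc q"] by (intro singular_lower_zero[OF g]) auto
qed

end

section \<open>Integrability\<close>

lemma pos_even: "i \<le> m \<Longrightarrow> pos m n i = (if i < n then 2 * i else n + i)"
  and pos_odd: "pos m n (Suc (m + i)) = 2 * i + 1"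
  by (simp_all add: pos_def)

lemma pos_lt: "n \<le> m \<Longrightarrow> x < dimN m n \<Longrightarrow> pos m n x < dimN m n"
  by (auto simp: pos_def dimN_def)

lemma inj_pos: "n \<le> m \<Longrightarrow> inj_on (pos m n) {..<dimN m n}"
  unfolding inj_on_def pos_def dimN_def by (auto split: if_splits) presburger+

lemma pos_even_less_iff: "i \<le> m \<Longrightarrow> j \<le> m \<Longrightarrow> pos m n i < pos m n j \<longleftrightarrow> i < j"
  by (auto simp: pos_def)

lemma sum_sgi_ocor:
  assumes "i < dimN m n" "j < dimN m n"
  shows "(\<Sum>x<dimN m n. sgi m x * (f x * ocor i j x)) = sgi m i * f i + sgi m j * f j"
proof -
  have "(\<Sum>x<dimN m n. sgi m x * (f x * ocor i j x)) = (\<Sum>x<dimN m n. if x = i then sgi m i * f i else 0)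
      + (\<Sum>x<dimN m n. if x = j then sgi m j * f j else 0)"
    unfolding sum.distrib[symmetric] by (intro sum.cong) (auto simp: ocor_def)
  then show ?thesis using assms by simp
qed

lemma sum_sgi_cor:
  assumes "i < dimN m n" "j < dimN m n"
  shows "(\<Sum>x<dimN m n. sgi m x * (f x * cor i j x)) = sgi m i * f i - sgi m j * f j"
proof -
  have "(\<Sum>x<dimN m n. sgi m x * (f x * cor i j x)) = (\<Sum>x<dimN m n. if x = i then sgi m i * f i else 0)
      - (\<Sum>x<dimN m n. if x = j then sgi m j * f j else 0)"
    unfolding sum_subtractf[symmetric] by (intro sum.cong) (auto simp: cor_def)
  then show ?thesis using assms by simp
qed

text \<open>The form has a sign on odd coordinates, so the difference \<open>beta\<close> is
  represented by a sum of diagonal units. Uniqueness is nondegeneracy of the form on supertraceless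
  diagonals. \<open>beta\<close> counts from 1, matrix indices from 0.\<close>

lemma hdual_beta:
  assumes "n \<le> m" "i < n"
  shows "hdual m n (beta m (Suc i)) = ocor i (Suc (m + i))"
proof -
  let ?N = "dimN m n" and ?h = "ocor i (Suc (m + i))"
  have lt: "i < ?N" "Suc (m + i) < ?N" "0 < ?N" using assms by (auto simp: dimN_def)
  have str: "str m n (matmul m n (diagmat h) (diagmat h')) = (\<Sum>x<?N. sgi m x * (h x * h' x))"
    if "sldiag m n h'" for h h'
    using that by (simp add: str_eq_sum matmul_diagmat_left sldiag_def slmat_def) (simp add: diagmat_def)
  note sub = sum_sgi_ocor[OF lt(1,2)]
  show ?thesis
    unfolding hdual_def
  proof (rule the_equality, intro conjI allI impI)
    show sh: "sldiag m n ?h"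
      using lt assms by (intro sldiag_ocor) (auto simp: odd_idx_def)
    show rep: "str m n (matmul m n (diagmat ?h) (diagmat h')) = beta m (Suc i) h'"
      if "sldiag m n h'" for h'
    proof -
      have "str m n (matmul m n (diagmat ?h) (diagmat h')) = (\<Sum>x<?N. sgi m x * (h' x * ?h x))"
        unfolding str[OF that] by (simp add: mult.commute)
      then show ?thesis
        unfolding sub using assms by (simp add: beta_def eps_def dlt_def sgi_def odd_idx_def)
    qed
    fix h
    assume h: "sldiag m n h \<and>
      (\<forall>h'. sldiag m n h' \<longrightarrow> str m n (matmul m n (diagmat h) (diagmat h')) = beta m (Suc i) h')"
    define d where "d x = h x - ?h x" for x
    have d0: "(\<Sum>x<?N. sgi m x * (d x * h' x)) = 0" if "sldiag m n h'" for h'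
      using h rep[OF that] that str[OF that, of h] str[OF that, of ?h]
      by (simp add: d_def left_diff_distrib right_diff_distrib sum_subtractf)
    \<comment> \<open>A difference \<open>d\<close> of two representatives pairs to 0 with the
      coroot joining \<open>x\<close> to 0, so it is constant; having supertrace 0, it
      vanishes.\<close>
    have const: "d x = d 0" if x: "x < ?N" for x
    proof (cases "odd_idx m x")
      case True
      have e0: "\<not> odd_idx m 0" by (simp add: odd_idx_def)
      have "(\<Sum>y<?N. sgi m y * (d y * ocor x 0 y)) = 0"
        using x lt True e0 by (intro d0 sldiag_ocor) auto
      then have "sgi m x * d x + sgi m 0 * d 0 = 0"
        unfolding sum_sgi_ocor[OF x lt(3)] .
      then show ?thesis using True e0 by (simp add: sgi_def)
    next
      case False
      have e0: "\<not> odd_idx m 0" by (simp add: odd_idx_def)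
      have "(\<Sum>y<?N. sgi m y * (d y * cor x 0 y)) = 0"
        using x lt False e0 by (intro d0 sldiag_cor) auto
      then have "sgi m x * d x - sgi m 0 * d 0 = 0"
        unfolding sum_sgi_cor[OF x lt(3)] .
      then show ?thesis using False e0 by (simp add: sgi_def)
    qed
    have "(\<Sum>x<?N. sgi m x * d x) = 0"
      using h sh by (simp add: sldiag_iff d_def right_diff_distrib sum_subtractf)
    moreover have "(\<Sum>x<?N. sgi m x * d x) = (\<Sum>x<?N. sgi m x * d 0)"
      by (intro sum.cong refl arg_cong2[where f = "(*)"] const) simp
    ultimately have "(\<Sum>x<?N. sgi m x) * d 0 = 0"
      by (simp add: sum_distrib_right)
    moreover have "(\<Sum>x<?N. sgi m x) \<noteq> 0"
      using sum_sgi_nonzero[of n m] assms(1) by simp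
    ultimately have "d 0 = 0" by simp
    then have "h x = ?h x" if "x < ?N" for x using const[OF that] by (simp add: d_def)
    moreover have "h x = ?h x" if "x \<ge> ?N" for x
      using h sh that unfolding sldiag_iff by simp
    ultimately show "h = ?h" by (meson ext not_le)
  qed
qed

section \<open>From simple roots to all real roots\<close>

context affine_module
begin

text \<open>A ladder with \<open>d = 1\<close>: the commutator of the two root vectors commutes with
  the first.\<close>

lemma loc_nilp_Emat_comp:
  assumes "i \<le> m" "j \<le> m" "l \<le> m" "i \<noteq> j" "j \<noteq> l" "i \<noteq> l"
    and nil: "loc_nilp (X r (Emat i j))" "loc_nilp (X s (Emat j l))"
  shows "loc_nilp (X (r + s) (Emat i l))"
proof -
  let ?F = "X r (Emat i j)"
  define A where "A t = (if t = 0 then X s (Emat j l)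
    else if t = 1 then X (r + s) (Emat i l) else (\<lambda>_. 0))" for t :: nat
  have N: "i < N" "j < N" "l < N" using assms by (auto simp: dimN_gt)
  have ev: "homog m False (Emat i j)" using assms by (auto simp: homog_def Emat_def odd_idx_def)
  have sl: "sl (Emat i j)" "sl (Emat j l)" "sl (Emat i l)"
    using N assms by (auto intro: slmat_Emat)
  have mm: "matmul m n (Emat i j) (Emat j l) = Emat i l" "matmul m n (Emat i j) (Emat i l) = (\<lambda>_ _. 0)"
    "com m n (Emat i j) (Emat j l) = Emat i l" "com m n (Emat i j) (Emat i l) = (\<lambda>_ _. 0)"
    using N assms by (auto simp: com_def matmul_Emat_left fun_eq_iff) (auto simp: Emat_def)
  have lin0: "lin (\<lambda>_. 0)"
    by (simp add: Vector_Spaces.linear_def module_hom_iff vector_space_axioms module_axioms)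
  have "loc_nilp (A 1)"
  proof (rule nilpotent_ladder[of ?F])
    show "lin ?F" using sl(1) by (rule lin_X)
    show "lin (A t)" for t using lin_X[OF sl(2)] lin_X[OF sl(3)] lin0 by (simp add: A_def)
    show "?F (A t u) = A t (?F u) + smul (of_nat (t + 1)) (A (t + 1) u)" for t u
      using X_com[OF sl(1) ev sl(2), of r s u] X_com[OF sl(1) ev sl(3), of r "r + s" u]
        lin_simps(3)[OF lin_X[OF sl(1)]] N assms
      by (simp add: A_def mm str_Emat) (simp add: str_def)
  qed (use nil in \<open>simp_all add: A_def\<close>)
  then show ?thesis by (simp add: A_def)
qed

text \<open>A ladder with \<open>d = 2\<close>: one commutator gives a diagonal element plus a
  central term, the next gives the root vector of the reflected root.\<close>

lemma loc_nilp_Emat_reflect: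
  assumes "i \<le> m" "j \<le> m" "i \<noteq> j"
    and nil: "loc_nilp (X r (Emat i j))" "loc_nilp (X s (Emat j i))"
  shows "loc_nilp (X (2 * r + s) (Emat i j))"
proof -
  let ?F = "X r (Emat i j)"
  define c where "c = (if r + s = 0 then of_int r else (0 :: complex))"
  define A where "A t = (if t = 0 then X s (Emat j i)
    else if t = 1 then (\<lambda>u. X (r + s) (diagmat (cor i j)) u + smul c (K u))
    else if t = 2 then (\<lambda>u. smul (-1) (X (2 * r + s) (Emat i j) u)) else (\<lambda>_. 0))" for t :: nat
  have N: "i < N" "j < N" using assms by (auto simp: dimN_gt)
  have ev: "homog m False (Emat i j)" using assms by (auto simp: homog_def Emat_def odd_idx_def)
  have sl: "sl (Emat i j)" "sl (Emat j i)" "sl (diagmat (cor i j))"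
    using N assms by (auto intro!: slmat_Emat sldiag_slmat sldiag_cor simp: odd_idx_def)
  have sgi: "sgi m i = 1" using assms by (simp add: sgi_def odd_idx_def)
  have mm: "matmul m n (Emat i j) (Emat j i) = Emat i i"
    "matmul m n (Emat i j) (diagmat (cor i j)) = (\<lambda>x y. - Emat i j x y)"
    "matmul m n (Emat i j) (Emat i j) = (\<lambda>_ _. 0)"
    "com m n (Emat i j) (Emat j i) = diagmat (cor i j)"
    "com m n (Emat i j) (diagmat (cor i j)) = (\<lambda>x y. (-2) * Emat i j x y)"
    "com m n (Emat i j) (Emat i j) = (\<lambda>_ _. 0)"
    using N assms
    by (simp_all add: com_def matmul_Emat_left matmul_Emat_right)
      (auto simp: fun_eq_iff diagmat_def cor_def Emat_def)
  have str: "str m n (Emat i i) = 1" "str m n (\<lambda>x y. - Emat i j x y) = 0" "str m n (\<lambda>_ _. 0) = 0"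
    using str_Emat[OF N(1), of i] str_Emat[OF N(1), of j] assms sgi
      str_comb[of m n "-1" "Emat i j" "\<lambda>_ _. 0"] by (simp_all add: str_def)
  note lX = lin_simps[OF lin_X[OF sl(1)]] lin_simps[OF lin_X[OF sl(2)]] lin_simps[OF lin_X[OF sl(3)]]
    lin_simps[OF lin_K]
  have lin0: "lin (\<lambda>_. 0)"
    by (simp add: Vector_Spaces.linear_def module_hom_iff vector_space_axioms module_axioms)
  have lin1: "lin (\<lambda>u. X (r + s) (diagmat (cor i j)) u + smul c (K u))"
    by (simp add: Vector_Spaces.linear_def module_hom_iff vector_space_axioms module_axioms
        lX scale_right_distrib mult.commute ac_simps)
  have lin2: "lin (\<lambda>u. smul (-1) (X (2 * r + s) (Emat i j) u))"
    by (simp add: Vector_Spaces.linear_def module_hom_iff vector_space_axioms module_axioms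
        lX scale_right_distrib)
  have "loc_nilp (A 2)"
  proof (rule nilpotent_ladder[of ?F])
    show "lin ?F" using sl(1) by (rule lin_X)
    show "lin (A t)" for t using lin_X[OF sl(2)] lin1 lin2 lin0 by (simp add: A_def)
    show "?F (A t u) = A t (?F u) + smul (of_nat (t + 1)) (A (t + 1) u)" for t u
    proof -
      have 0: "?F (X s (Emat j i) u) = X s (Emat j i) (?F u)
          + (X (r + s) (diagmat (cor i j)) u + smul c (K u))"
        using X_com[OF sl(1) ev sl(2), of r s u] by (simp add: mm str c_def add.assoc)
      have rs: "r + (r + s) = 2 * r + s" by simp
      have 1: "?F (X (r + s) (diagmat (cor i j)) u) = X (r + s) (diagmat (cor i j)) (?F u)
          + smul (-2) (X (2 * r + s) (Emat i j) u)"
        using X_com[OF sl(1) ev sl(3), of r "r + s" u]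
        unfolding mm str X_scale[OF sl(1)] rs by simp
      have 2: "?F (X (2 * r + s) (Emat i j) u) = X (2 * r + s) (Emat i j) (?F u)"
        using X_com[OF sl(1) ev sl(1), of r "2 * r + s" u] by (simp add: mm str)
      consider "t = 0" | "t = 1" | "t = 2" | "t > 2" by linarith
      then show ?thesis
      proof cases
        case 1
        then show ?thesis using 0 by (simp add: A_def)
      next
        case 2
        then show ?thesis using 1 by (simp add: A_def lX K_X[OF sl(1)] ac_simps)
      next
        case 3
        then show ?thesis using 2 by (simp add: A_def lX)
      next
        case 4
        then show ?thesis by (simp add: A_def lX)
      qed
    qed
  qed (use nil in \<open>simp_all add: A_def\<close>)
  then have n2: "loc_nilp (\<lambda>u. smul (-1) (X (2 * r + s) (Emat i j) u))" by (simp add: A_def)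
  have "((\<lambda>u. smul (-1) (X (2 * r + s) (Emat i j) u)) ^^ t) u
      = smul ((-1) ^ t) ((X (2 * r + s) (Emat i j) ^^ t) u)" for t u
    by (induction t) (simp_all add: lX)
  then show ?thesis using n2 unfolding loc_nilp_def by simp
qed

lemma integrable_if_simple:
  assumes m: "m > 0"
    and low: "\<And>i. i < m \<Longrightarrow> loc_nilp (X 0 (Emat (Suc i) i))"
    and aff: "loc_nilp (X (-1) (Emat 0 m))"
  shows "integrable m n X"
proof -
  have L0: "loc_nilp (X 0 (Emat j i))" if "i < j" "j \<le> m" for i j
    using that
  proof (induction j)
    case (Suc j)
    show ?case
    proof (cases "i = j")
      case False
      then show ?thesis
        using loc_nilp_Emat_comp[of "Suc j" j i 0 0] low[of j] Suc by simp
    qed (use low Suc in simp)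
  qed simp
  have U0: "loc_nilp (X (-1) (Emat 0 j))" if "0 < j" "j \<le> m" for j
    using loc_nilp_Emat_comp[of 0 m j "-1" 0] aff L0[of j m] that m by (cases "j = m") auto
  have U1: "loc_nilp (X (-1) (Emat i j))" if "i < j" "j \<le> m" for i j
    using loc_nilp_Emat_comp[of i 0 j 0 "-1"] U0[of j] L0[of 0 i] that by (cases "i = 0") auto
  \<comment> \<open>The two families alternate: reflecting at level 0 turns \<open>Emat i j\<close>
    into \<open>Emat j i\<close> at the same level, and reflecting at level -1 turns
    \<open>Emat j i\<close> at level \<open>- s\<close> into \<open>Emat i j\<close> at level
    \<open>- s - 2\<close>.\<close>
  have LU: "loc_nilp (X (- int s) (Emat j i)) \<and> loc_nilp (X (- int (Suc s)) (Emat i j))"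
    if "i < j" "j \<le> m" for i j s
  proof (induction s)
    case 0
    show ?case using L0[OF that] U1[OF that] by simp
  next
    case (Suc s)
    have "loc_nilp (X (- int (Suc s)) (Emat j i))"
      using loc_nilp_Emat_reflect[of j i 0 "- int (Suc s)"] Suc that L0[OF that] by simp
    moreover have "loc_nilp (X (2 * (-1) + - int s) (Emat i j))"
      using Suc that U1[OF that] by (intro loc_nilp_Emat_reflect) auto
    then have "loc_nilp (X (- int (Suc (Suc s))) (Emat i j))"
      by (simp add: algebra_simps)
    ultimately show ?case by simp
  qed
  show ?thesis
    unfolding integrable_def
  proof (intro allI impI conjI, elim conjE)
    fix i j assume "i \<le> m" "j \<le> m" "i \<noteq> j" "pos m n i < pos m n j"
    then show "loc_nilp (X 0 (Emat j i))" using L0 by (simp add: pos_even_less_iff)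
  next
    fix i j and r :: int
    assume ij: "i \<le> m \<and> j \<le> m \<and> i \<noteq> j" and r: "r > 0"
    obtain s where s: "r = int (Suc s)" using zero_less_imp_eq_int[OF r] gr0_implies_Suc by blast
    show "loc_nilp (X (- r) (Emat j i))"
      using LU[of i j "Suc s"] LU[of j i s] ij unfolding s by (cases "i < j") auto
  qed
qed

end

section \<open>Odd reflections and coroot values\<close>

context hw_module
begin

definition raising :: "(nat \<Rightarrow> nat) \<Rightarrow> bool" where
  "raising \<pi> \<longleftrightarrow> (\<forall>a. sl a \<and> (\<forall>i j. a i j \<noteq> 0 \<longrightarrow> \<pi> i < \<pi> j) \<longrightarrow> X 0 a v = 0)"

lemma v_pos: "r > 0 \<Longrightarrow> sl a \<Longrightarrow> X r a v = 0"
  using hw unfolding hw_vector_def by blast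

lemma raising_pos: "raising (pos m n)"
  using hw unfolding hw_vector_def raising_def upper_def by blast

lemma raising_singular:
  assumes lt: "\<And>x. x < N \<Longrightarrow> \<pi> x < N" and R: "raising \<pi>"
  shows "singular \<pi> v"
  unfolding singular_def
proof (intro allI impI, elim conjE)
  fix r p d a
  assume a: "gr \<pi> p d a" and pos: "d + r * int N > 0"
  have sa: "sl a" using a by (simp add: graded_def)
  show "X r a v = 0"
  proof (cases "\<exists>i j. a i j \<noteq> 0")
    case True
    then obtain i j where ij: "a i j \<noteq> 0" by blast
    then have "i < N" "j < N"
      using sa unfolding slmat_def is_mat_def by (meson not_le)+
    then have b: "\<pi> i < N" "\<pi> j < N" using lt by auto
    have "int (\<pi> j) - int (\<pi> i) = d" using a ij by (simp add: graded_def)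
    then have "(-1) * int N < r * int N" using b pos by linarith
    then have "r \<ge> 0" by (simp only: mult_less_cancel_right) auto
    then consider "r > 0" | "r = 0" by linarith
    then show ?thesis
    proof cases
      case 1
      then show ?thesis using sa by (rule v_pos)
    next
      case 2
      have "\<pi> x < \<pi> y" if "a x y \<noteq> 0" for x y
      proof -
        have "int (\<pi> y) - int (\<pi> x) = d" using a that by (simp add: graded_def)
        then show ?thesis using pos 2 by simp
      qed
      then show ?thesis using R sa 2 unfolding raising_def by blast
    qed
  next
    case False
    then have "a = (\<lambda>_ _. 0)" by blast
    then show ?thesis by simp
  qed
qed

lemma simple_root_raises:
  assumes "simple_root \<pi> i j r" "singular \<pi> v"
  shows "X r (Emat i j) v = 0"
  using assms graded_Emat[of i m n j \<pi>] unfolding simple_root_def singular_def by fastforce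

text \<open>If \<open>(\<Lambda>|\<beta>) = 0\<close> for a simple odd isotropic root \<open>\<beta>\<close>, then \<open>v\<close> remains a highest weight
  vector for the system of simple roots reflected in \<open>\<beta>\<close>.\<close>

lemma odd_reflection:
  assumes sr: "simple_root \<pi> i j 0" and R: "raising \<pi>"
    and odd: "odd_idx m i \<noteq> odd_idx m j" and lam: "lam (ocor i j) = 0"
  shows "raising (\<pi>(i := \<pi> j, j := \<pi> i))"
proof -
  have ij: "i < N" "j < N" "i \<noteq> j" and deg: "int (\<pi> j) - int (\<pi> i) = 1"
    and inj: "inj_on \<pi> {..<N}" and lt: "\<And>x. x < N \<Longrightarrow> \<pi> x < N"
    using sr by (auto simp: simple_root_def)
  have sv: "singular \<pi> v" using lt R by (rule raising_singular)
  have sE: "sl (Emat j i)" using ij by (intro slmat_Emat) auto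
  \<comment> \<open>The anticommutator acts on \<open>v\<close> by
    \<open>lam (ocor i j) = 0\<close>; so the first string vector is already killed and hence
    zero.\<close>
  have "X 0 (Emat i j) (X (-0) (Emat j i) v) = 0"
    using X_Emat_pair[OF ij, of 0 v] odd simple_root_raises[OF sr sv]
      v_diag[OF sldiag_ocor[OF ij(1,2) odd]] lam lin_simps(3)[OF lin_X[OF sE]] by simp
  then have fv: "X 0 (Emat j i) v = 0"
    using simple_string_zero[OF sr sv, of 0] by simp
  show ?thesis
    unfolding raising_def
  proof (intro allI impI, elim conjE)
    fix a assume sa: "sl a" and up: "\<forall>x y. a x y \<noteq> 0 \<longrightarrow>
      (\<pi>(i := \<pi> j, j := \<pi> i)) x < (\<pi>(i := \<pi> j, j := \<pi> i)) y"
    let ?b = "\<lambda>x y. (- a j i) * Emat j i x y + a x y"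
    \<comment> \<open>Swapping neighbouring positions changes the order of this one pair only, so
      without its \<open>Emat j i\<close> component \<open>a\<close> raises for the old
      order.\<close>
    have "\<pi> x < \<pi> y" if "?b x y \<noteq> 0" for x y
    proof -
      have ne: "\<not> (x = j \<and> y = i)" and axy: "a x y \<noteq> 0"
        using that by (auto simp: Emat_def split: if_splits)
      have "x < N" "y < N"
        using axy sa unfolding slmat_def is_mat_def by (meson not_le)+
      then have "x \<noteq> i \<Longrightarrow> \<pi> x \<noteq> \<pi> i" "x \<noteq> j \<Longrightarrow> \<pi> x \<noteq> \<pi> j"
        "y \<noteq> i \<Longrightarrow> \<pi> y \<noteq> \<pi> i" "y \<noteq> j \<Longrightarrow> \<pi> y \<noteq> \<pi> j"
        using inj ij by (auto dest: inj_onD)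
      moreover have "(if x = j then \<pi> i else if x = i then \<pi> j else \<pi> x)
          < (if y = j then \<pi> i else if y = i then \<pi> j else \<pi> y)"
        using up axy unfolding fun_upd_def by blast
      moreover have "\<pi> j = Suc (\<pi> i)" using deg by simp
      ultimately show ?thesis using ne ij(3) by (auto split: if_splits)
    qed
    then have "X 0 ?b v = 0" using R slmat_comb[OF sE sa] unfolding raising_def by blast
    then show "X 0 a v = 0" using X_comb[OF sE sa, of 0 "- a j i" v] fv by simp
  qed
qed

text \<open>The factor \<open>c - q\<close> in \<open>sl2_raise\<close> vanishes, so string vector
  \<open>q + 1\<close> is killed and hence zero.\<close>

lemma coroot_nat_imp_loc_nilp:
  assumes ij: "i \<le> m" "j \<le> m" and sr: "simple_root \<pi> i j r" and R: "raising \<pi>"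
    and q: "lam (cor i j) + of_int r * k = of_nat q"
  shows "loc_nilp (X (-r) (Emat j i))"
proof -
  let ?e = "X r (Emat i j)" and ?f = "X (-r) (Emat j i)"
  let ?h = "\<lambda>u. X 0 (diagmat (cor i j)) u + smul (of_int r) (K u)"
  have ne: "i \<noteq> j" and N: "i < N" "j < N" and sv: "singular \<pi> v"
    using sr R by (auto simp: simple_root_def intro: raising_singular)
  have cor: "sldiag m n (cor i j)" using N ij by (intro sldiag_cor) (auto simp: odd_idx_def)
  have lin: "lin ?e" "lin ?f" using N ne by (auto intro!: lin_X slmat_Emat)
  have "?e ((?f ^^ Suc q) v)
      = smul (of_nat (Suc q) * ((lam (cor i j) + of_int r * k) - of_nat q)) ((?f ^^ q) v)"
  proof (rule sl2_raise[where h = ?h])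
    show "lin ?e" "lin ?f" by (fact lin)+
    show "lin ?h" using ij ne by (rule X_Emat_sl2)
    show "?e (?f u) = ?f (?e u) + ?h u" for u using ij ne by (rule X_Emat_sl2)
    show "?h (?f u) = ?f (?h u) - smul 2 (?f u)" for u using ij ne by (rule X_Emat_sl2)
    show "?e v = 0" using sr sv by (rule simple_root_raises)
    show "X 0 (diagmat (cor i j)) v + smul (of_int r) (K v) = smul (lam (cor i j) + of_int r * k) v"
      by (simp add: v_diag[OF cor] v_K scale_left_distrib)
  qed
  then have "?e ((?f ^^ Suc q) v) = 0" using q by simp
  then have "(?f ^^ Suc q) v = 0" by (rule simple_string_zero[OF sr sv])
  then show ?thesis
    using ij ne by (intro nilpotent_Emat) (auto simp: nil_set_def intro: exI[of _ "Suc q"])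
qed

text \<open>Applies to any root vector killing \<open>v\<close>, so this direction requires no odd
  reflection.\<close>

lemma loc_nilp_imp_coroot_nat:
  assumes ij: "i \<le> m" "j \<le> m" "i \<noteq> j" and e: "X r (Emat i j) v = 0"
    and nil: "loc_nilp (X (-r) (Emat j i))"
  shows "\<exists>q::nat. lam (cor i j) + of_int r * k = of_nat q"
proof -
  let ?e = "X r (Emat i j)" and ?f = "X (-r) (Emat j i)"
  let ?h = "\<lambda>u. X 0 (diagmat (cor i j)) u + smul (of_int r) (K u)"
  have N: "i < N" "j < N" using ij by (auto simp: dimN_gt)
  have cor: "sldiag m n (cor i j)" using N ij by (intro sldiag_cor) (auto simp: odd_idx_def)
  have lin: "lin ?e" "lin ?f" using N ij by (auto intro!: lin_X slmat_Emat)
  obtain t where t: "(?f ^^ t) v = 0" using nil unfolding loc_nilp_def by blast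
  show ?thesis
  proof (rule sl2_nilpotent_imp_nat[where h = ?h, OF lin _ _ _ e _ v_nz t])
    show "lin ?h" using ij by (rule X_Emat_sl2)
    show "?e (?f u) = ?f (?e u) + ?h u" for u using ij by (rule X_Emat_sl2)
    show "?h (?f u) = ?f (?h u) - smul 2 (?f u)" for u using ij by (rule X_Emat_sl2)
    show "X 0 (diagmat (cor i j)) v + smul (of_int r) (K v) = smul (lam (cor i j) + of_int r * k) v"
      by (simp add: v_diag[OF cor] v_K scale_left_distrib)
  qed
qed

lemma lam_sum:
  assumes "finite S" "\<And>i. i \<in> S \<Longrightarrow> sldiag m n (f i)"
  shows "sldiag m n (\<lambda>x. \<Sum>i\<in>S. c i * f i x) \<and>
    lam (\<lambda>x. \<Sum>i\<in>S. c i * f i x) = (\<Sum>i\<in>S. c i * lam (f i))"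
  using assms
proof induction
  case empty
  have z: "sldiag m n (\<lambda>_. 0)" by (simp add: sldiag_iff)
  show ?case using lam_comb[OF z z, of 1] z by simp
next
  case (insert i S)
  have "sldiag m n (\<lambda>x. c i * f i x + (\<Sum>i\<in>S. c i * f i x))"
    using insert slmat_comb[of m n "diagmat (f i)" "diagmat (\<lambda>x. \<Sum>i\<in>S. c i * f i x)" "c i"]
    unfolding sldiag_iff by (simp add: distrib_left sum.distrib sum_distrib_left[symmetric] mult.left_commute)
  then show ?case using insert lam_comb[of "f i" "\<lambda>x. \<Sum>i\<in>S. c i * f i x" "c i"] by simp
qed

lemma lam_zero: "lam (\<lambda>_. 0) = 0"
  using lam_sum[of "{}"] by simp

lemma lam_cor_Suc:
  assumes "i < m"
  shows "lam (cor i (Suc i)) = lam (cor i m) - lam (cor (Suc i) m)"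
proof -
  have "cor i (Suc i) = (\<lambda>x. (-1) * cor (Suc i) m x + cor i m x)"
    by (auto simp: cor_def fun_eq_iff)
  moreover have "sldiag m n (cor (Suc i) m)" "sldiag m n (cor i m)"
    using assms by (auto intro!: sldiag_cor simp: dimN_def odd_idx_def)
  ultimately show ?thesis using lam_comb[of "cor (Suc i) m" "cor i m" "-1"] by simp
qed

lemma lam_cor_self: "lam (cor i i) = 0"
proof -
  have "cor i i = (\<lambda>_. 0)" by (simp add: cor_def fun_eq_iff)
  then show ?thesis using lam_zero by simp
qed

lemma lam_cor_flip: "lam (cor m 0) = - lam (cor 0 m)"
proof -
  have "cor m 0 = (\<lambda>x. (-1) * cor 0 m x + (\<lambda>_. 0) x)"
    by (auto simp: cor_def fun_eq_iff)
  moreover have "sldiag m n (cor 0 m)" by (intro sldiag_cor) (auto simp: dimN_def odd_idx_def)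
  moreover have "sldiag m n (\<lambda>_. 0)" by (simp add: sldiag_iff)
  ultimately show ?thesis using lam_comb[of "cor 0 m" "\<lambda>_. 0" "-1"] lam_zero by simp
qed

text \<open>\<open>h\<close> is expanded in the \<open>ocor i (Suc (m + i))\<close>, on which
  \<open>lam\<close> vanishes, and the \<open>cor i m\<close>.\<close>

lemma lam_expand:
  assumes odd: "\<forall>i<n. lam (ocor i (Suc (m + i))) = 0" and h: "sldiag m n h"
  shows "lam h = (\<Sum>i<m. (h i - (if i < n then h (Suc (m + i)) else 0)) * lam (cor i m))"
proof -
  let ?x = "\<lambda>i. h i - (if i < n then h (Suc (m + i)) else 0)"
  let ?a = "\<lambda>x. \<Sum>i<n. h (Suc (m + i)) * ocor i (Suc (m + i)) x"
  let ?b = "\<lambda>x. \<Sum>i<m. ?x i * cor i m x"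
  have A: "sldiag m n ?a \<and> lam ?a = (\<Sum>i<n. h (Suc (m + i)) * lam (ocor i (Suc (m + i))))"
    using nm by (intro lam_sum sldiag_ocor) (auto simp: dimN_def odd_idx_def)
  have B: "sldiag m n ?b \<and> lam ?b = (\<Sum>i<m. ?x i * lam (cor i m))"
    by (intro lam_sum sldiag_cor) (auto simp: dimN_def odd_idx_def)
  have a: "?a x = (if x < n then h (Suc (m + x)) else 0) + (if x > m \<and> x < N then h x else 0)" for x
  proof -
    have "?a x = (\<Sum>i<n. (if i = x then h (Suc (m + i)) else 0))
        + (\<Sum>i<n. (if Suc (m + i) = x then h (Suc (m + i)) else 0))"
      unfolding sum.distrib[symmetric] by (intro sum.cong) (auto simp: ocor_def)
    also have "(\<Sum>i<n. (if Suc (m + i) = x then h (Suc (m + i)) else 0))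
        = (\<Sum>i<n. (if i = x - Suc m then if x > m then h x else 0 else 0))"
      by (intro sum.cong) auto
    also have "\<dots> = (if x > m \<and> x < N then h x else 0)" by (auto simp: dimN_def)
    finally show ?thesis by simp
  qed
  have b: "?b x = (if x < m then ?x x else 0) - (if x = m then \<Sum>i<m. ?x i else 0)" for x
  proof -
    have "?b x = (\<Sum>i<m. (if i = x then ?x i else 0)) - (\<Sum>i<m. if x = m then ?x i else 0)"
      unfolding sum_subtractf[symmetric] by (intro sum.cong) (auto simp: cor_def)
    then show ?thesis by simp
  qed
  \<comment> \<open>The other coordinates match by construction; coordinate \<open>m\<close> does
    because \<open>h\<close> has supertrace 0.\<close>
  have "str m n (diagmat h) = 0" using h by (simp add: sldiag_def slmat_def)
  then have "(\<Sum>i<m + 1. h i) = (\<Sum>i\<in>{m + 1..<N}. h i)"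
    by (simp add: str_def diagmat_def)
  also have "\<dots> = (\<Sum>i<n. h (Suc (m + i)))"
    by (rule sum.reindex_bij_witness[of _ "\<lambda>i. Suc (m + i)" "\<lambda>i. i - Suc m"]) (auto simp: dimN_def)
  also have "\<dots> = (\<Sum>i<m. if i < n then h (Suc (m + i)) else 0)"
    using nm by (intro sum.mono_neutral_cong_left) auto
  finally have hm: "h m = - (\<Sum>i<m. ?x i)" by (simp add: sum_subtractf algebra_simps)
  have "h x = 1 * ?a x + ?b x" for x
    unfolding a b using hm h nm by (auto simp: sldiag_iff)
  then have "h = (\<lambda>x. 1 * ?a x + ?b x)" by blast
  then have "lam h = 1 * lam ?a + lam ?b" using lam_comb[of ?a ?b 1] A B by metis
  then show ?thesis using A B odd by simp
qed

end

lemma weight_sum: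
  assumes "n \<le> m"
  shows "(\<Sum>i=1..n. of_int (ks i) * beta m i h) + (\<Sum>i\<in>{n+1..m}. of_int (ks i) * eps i h)
    = (\<Sum>i<m. (h i - (if i < n then h (Suc (m + i)) else 0)) * of_int (ks (Suc i)))"
proof -
  have 1: "(\<Sum>i=1..n. of_int (ks i) * beta m i h)
      = (\<Sum>i<n. (h i - (if i < n then h (Suc (m + i)) else 0)) * of_int (ks (Suc i)))"
    by (rule sum.reindex_bij_witness[of _ Suc "\<lambda>i. i - 1"])
      (auto simp: beta_def eps_def dlt_def)
  have 2: "(\<Sum>i\<in>{n+1..m}. of_int (ks i) * eps i h)
      = (\<Sum>i\<in>{n..<m}. (h i - (if i < n then h (Suc (m + i)) else 0)) * of_int (ks (Suc i)))"
    by (rule sum.reindex_bij_witness[of _ Suc "\<lambda>i. i - 1"]) (auto simp: eps_def)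
  have "{..<m} = {..<n} \<union> {n..<m}" using assms by auto
  then show ?thesis
    unfolding 1 2 by (simp only: sum.union_disjoint[symmetric] finite_lessThan finite_atLeastLessThan
      ivl_disj_int)
qed

context hw_module
begin

lemma weight_formula_iff:
  assumes odd: "\<forall>i<n. lam (ocor i (Suc (m + i))) = 0"
  shows "(\<forall>h. sldiag m n h \<longrightarrow> lam h = (\<Sum>i=1..n. of_int (ks i) * beta m i h)
            + (\<Sum>i\<in>{n+1..m}. of_int (ks i) * eps i h))
    \<longleftrightarrow> (\<forall>i<m. lam (cor i m) = of_int (ks (Suc i)))"
  unfolding weight_sum[OF nm]
proof
  assume F: "\<forall>h. sldiag m n h \<longrightarrow>
    lam h = (\<Sum>i<m. (h i - (if i < n then h (Suc (m + i)) else 0)) * of_int (ks (Suc i)))"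
  show "\<forall>i<m. lam (cor i m) = of_int (ks (Suc i))"
  proof (intro allI impI)
    fix i assume i: "i < m"
    have "sldiag m n (cor i m)" using i by (intro sldiag_cor) (auto simp: dimN_def odd_idx_def)
    then have "lam (cor i m) = (\<Sum>t<m. (cor i m t - (if t < n then cor i m (Suc (m + t)) else 0))
        * of_int (ks (Suc t)))"
      using F by blast
    also have "\<dots> = (\<Sum>t<m. if t = i then of_int (ks (Suc i)) else 0)"
      using i by (intro sum.cong) (auto simp: cor_def)
    finally show "lam (cor i m) = of_int (ks (Suc i))" using i by simp
  qed
next
  assume "\<forall>i<m. lam (cor i m) = of_int (ks (Suc i))"
  then show "\<forall>h. sldiag m n h \<longrightarrow>
    lam h = (\<Sum>i<m. (h i - (if i < n then h (Suc (m + i)) else 0)) * of_int (ks (Suc i)))"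
    using lam_expand[OF odd] by simp
qed

lemma integrable_iff_nat:
  assumes n: "1 \<le> n" and odd: "\<forall>i<n. lam (ocor i (Suc (m + i))) = 0"
  shows "integrable m n X \<longleftrightarrow>
    (\<forall>i<m. \<exists>q::nat. lam (cor i (Suc i)) = of_nat q) \<and> (\<exists>q::nat. k - lam (cor 0 m) = of_nat q)"
proof
  assume I: "integrable m n X"
  show "(\<forall>i<m. \<exists>q::nat. lam (cor i (Suc i)) = of_nat q) \<and> (\<exists>q::nat. k - lam (cor 0 m) = of_nat q)"
  proof (intro conjI allI impI)
    fix i assume i: "i < m"
    have "pos m n i < pos m n (Suc i)" using i by (simp add: pos_even_less_iff)
    moreover have "sl (Emat i (Suc i))" using i by (intro slmat_Emat) (auto simp: dimN_def)
    ultimately have "X 0 (Emat i (Suc i)) v = 0"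
      using raising_pos unfolding raising_def by (auto simp: Emat_def)
    moreover have "loc_nilp (X 0 (Emat (Suc i) i))"
      using I i \<open>pos m n i < pos m n (Suc i)\<close> unfolding integrable_def by auto
    ultimately show "\<exists>q::nat. lam (cor i (Suc i)) = of_nat q"
      using loc_nilp_imp_coroot_nat[of i "Suc i" 0] i by simp
  next
    have "sl (Emat m 0)" using n nm by (intro slmat_Emat) (auto simp: dimN_def)
    then have "X 1 (Emat m 0) v = 0" by (intro v_pos) auto
    moreover have "loc_nilp (X (-1) (Emat 0 m))"
      using I n nm unfolding integrable_def by auto
    ultimately show "\<exists>q::nat. k - lam (cor 0 m) = of_nat q"
      using loc_nilp_imp_coroot_nat[of m 0 1] n nm by (simp add: lam_cor_flip)
  qed
next
  assume Q: "(\<forall>i<m. \<exists>q::nat. lam (cor i (Suc i)) = of_nat q) \<and> (\<exists>q::nat. k - lam (cor 0 m) = of_nat q)"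
  have inj: "inj_on (pos m n) {..<N}" and lt: "\<And>x. x < N \<Longrightarrow> pos m n x < N"
    using inj_pos[OF nm] pos_lt[OF nm] by auto
  have "loc_nilp (X 0 (Emat (Suc i) i))" if i: "i < m" for i
  proof -
    obtain q :: nat where q: "lam (cor i (Suc i)) + of_int 0 * k = of_nat q" using Q i by auto
    show ?thesis
    proof (cases "i < n")
      case False
      have "simple_root (pos m n) i (Suc i) 0"
        unfolding simple_root_def using inj lt i False by (simp add: dimN_def pos_even)
      from coroot_nat_imp_loc_nilp[OF _ _ this raising_pos q] i show ?thesis by simp
    next
      case True
      let ?j = "Suc (m + i)"
      \<comment> \<open>After the swap \<open>i\<close> has position \<open>2 * i + 1\<close>, next
        to \<open>Suc i\<close> at \<open>2 * i + 2\<close>, also when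
        \<open>Suc i = n\<close>.\<close>
      let ?\<pi> = "(pos m n)(i := pos m n ?j, ?j := pos m n i)"
      have ij: "i < N" "?j < N" using i True by (auto simp: dimN_def)
      have "simple_root (pos m n) i ?j 0"
        unfolding simple_root_def using inj lt ij i True by (simp add: pos_even pos_odd)
      then have R: "raising ?\<pi>"
        using raising_pos odd True i by (intro odd_reflection) (auto simp: odd_idx_def)
      have "inj_on ?\<pi> {..<N}"
        using inj ij unfolding inj_on_def by (auto simp: fun_upd_def split: if_splits)
      then have "simple_root ?\<pi> i (Suc i) 0"
        unfolding simple_root_def using lt ij i True
        by (auto simp: pos_even pos_odd dimN_def)
      from coroot_nat_imp_loc_nilp[OF _ _ this R q] i show ?thesis by simp
    qed
  qed
  moreover have "loc_nilp (X (-1) (Emat 0 m))"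
  proof -
    obtain q :: nat where q: "lam (cor m 0) + of_int 1 * k = of_nat q"
      using Q by (auto simp: lam_cor_flip)
    \<comment> \<open>The root \<delta> - \<theta>: \<open>m\<close> has the last position
      \<open>N - 1\<close> and 0 the first.\<close>
    have "simple_root (pos m n) m 0 1"
      unfolding simple_root_def using inj lt n nm by (simp add: dimN_def pos_even)
    from coroot_nat_imp_loc_nilp[OF _ _ this raising_pos q] show ?thesis by simp
  qed
  ultimately show "integrable m n X" using n nm by (intro integrable_if_simple) auto
qed

end

theorem theorem5p4:
  fixes m n :: nat
    and smul :: "complex \<Rightarrow> 'v::ab_group_add \<Rightarrow> 'v"
    and X :: "int \<Rightarrow> cmat \<Rightarrow> 'v \<Rightarrow> 'v" and K D :: "'v \<Rightarrow> 'v"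
    and lam :: "(nat \<Rightarrow> complex) \<Rightarrow> complex" and k ld :: complex
  assumes "1 \<le> n" and "n \<le> m"
    and "is_L m n smul X K D lam k ld"
    and "k \<noteq> 0"
    and "\<forall>i\<in>{1..n}. hform m n lam (beta m i) = 0"
  shows "integrable m n X \<longleftrightarrow>
    (\<exists>c::complex. \<exists>kk::int. \<exists>ks::nat \<Rightarrow> int.
       k = of_int kk \<and> ld = c \<and>
       (\<forall>h. sldiag m n h \<longrightarrow>
          lam h = (\<Sum>i=1..n. of_int (ks i) * beta m i h)
                  + (\<Sum>i\<in>{n+1..m}. of_int (ks i) * eps i h)) \<and>
       kk > 0 \<and> (\<forall>i\<in>{1..m}. ks i \<ge> 0) \<and> kk \<ge> ks 1 \<and>
       (\<forall>i\<in>{1..<m}. ks i \<ge> ks (i + 1)))"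
proof -
  obtain v where hw: "hw_vector m n smul X K D lam k ld v"
    and rep: "affine_rep m n smul X K D" and irr: "irreducible_rep m n smul X K D"
    using assms(3) unfolding is_L_def by blast
  have "Vector_Spaces.vector_space smul" using rep by (simp add: affine_rep_def)
  then interpret hw_module smul m n X K D lam k ld v
    using rep irr hw assms(2)
    by (simp add: hw_module_def hw_module_axioms_def affine_module_def affine_module_axioms_def
        complex_space_def)
  have odd: "\<forall>i<n. lam (ocor i (Suc (m + i))) = 0"
  proof (intro allI impI)
    fix i assume i: "i < n"
    then have "hform m n lam (beta m (Suc i)) = 0" using assms(5) by simp
    then show "lam (ocor i (Suc (m + i))) = 0"
      by (simp add: hform_def hdual_beta[OF assms(2) i])
  qed
  define a where "a i = lam (cor i m)" for i
  have am: "a m = 0" by (simp add: a_def lam_cor_self)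
  have "((\<forall>i<m. \<exists>q::nat. lam (cor i (Suc i)) = of_nat q) \<and> (\<exists>q::nat. k - lam (cor 0 m) = of_nat q))
    \<longleftrightarrow> (\<exists>c::complex. \<exists>kk::int. \<exists>ks::nat \<Rightarrow> int. k = of_int kk \<and> ld = c \<and>
       (\<forall>i<m. lam (cor i m) = of_int (ks (Suc i))) \<and>
       kk > 0 \<and> (\<forall>i\<in>{1..m}. ks i \<ge> 0) \<and> kk \<ge> ks 1 \<and> (\<forall>i\<in>{1..<m}. ks i \<ge> ks (i + 1)))" (is "?nat \<longleftrightarrow> ?weight")
  proof
    assume Q: ?nat
    then obtain q :: "nat \<Rightarrow> nat" where q: "\<And>i. i < m \<Longrightarrow> lam (cor i (Suc i)) = of_nat (q i)"
      by metis
    obtain q0 :: nat where q0: "k - a 0 = of_nat q0" using Q unfolding a_def by blast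
    \<comment> \<open>The coroot values telescope from \<open>a m = 0\<close>, so \<open>s i\<close>
      is the sought coefficient with index \<open>i + 1\<close>.\<close>
    define s where "s i = (\<Sum>t\<in>{i..<m}. q t)" for i
    have as: "a (m - t) = of_nat (s (m - t))" if "t \<le> m" for t
      using that
    proof (induction t)
      case 0
      then show ?case by (simp add: am s_def)
    next
      case (Suc t)
      let ?i = "m - Suc t"
      have i: "?i < m" "Suc ?i = m - t" using Suc.prems by auto
      have "a ?i = of_nat (q ?i) + a (Suc ?i)"
        using q[OF i(1)] lam_cor_Suc[OF i(1)] by (simp add: a_def diff_eq_eq)
      moreover have "s ?i = q ?i + s (Suc ?i)"
        unfolding s_def using i(1) by (simp add: sum.atLeast_Suc_lessThan)
      ultimately show ?case using Suc i(2) by simp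
    qed
    have as': "a i = of_nat (s i)" if "i \<le> m" for i using as[of "m - i"] that by simp
    have k: "k = of_nat (q0 + s 0)" using q0 as'[of 0] by (simp add: algebra_simps)
    have anti: "s (Suc i) \<le> s i" for i
      unfolding s_def by (intro sum_mono2) auto
    have "k = of_int (int (q0 + s 0)) \<and> ld = ld \<and>
       (\<forall>i<m. lam (cor i m) = of_int ((\<lambda>i. int (s (i - 1))) (Suc i))) \<and>
       int (q0 + s 0) > 0 \<and> (\<forall>i\<in>{1..m}. int (s (i - 1)) \<ge> 0) \<and> int (q0 + s 0) \<ge> int (s (1 - 1)) \<and>
       (\<forall>i\<in>{1..<m}. int (s (i - 1)) \<ge> int (s (i + 1 - 1)))"
    proof (intro conjI)
      show "int (q0 + s 0) > 0" using k assms(4) by (metis of_nat_0 of_nat_0_less_iff gr0I)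
      show "\<forall>i\<in>{1..<m}. int (s (i - 1)) \<ge> int (s (i + 1 - 1))"
        using anti by (metis Suc_diff_1 add_diff_cancel_right' atLeastLessThan_iff less_le_trans
            of_nat_mono zero_less_one)
    qed (use k as' in \<open>auto simp: a_def\<close>)
    then show ?weight
      by - (rule exI[of _ ld], rule exI[of _ "int (q0 + s 0)"], rule exI[of _ "\<lambda>i. int (s (i - 1))"], assumption)
  next
    assume ?weight
    then obtain kk :: int and ks :: "nat \<Rightarrow> int" where kk: "k = of_int kk"
      and ks: "\<And>i. i < m \<Longrightarrow> a i = of_int (ks (Suc i))"
      and nn: "\<And>i. i \<in> {1..m} \<Longrightarrow> ks i \<ge> 0" and k1: "kk \<ge> ks 1"
      and anti: "\<And>i. i \<in> {1..<m} \<Longrightarrow> ks i \<ge> ks (i + 1)"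
      unfolding a_def by blast
    have nat: "\<exists>q::nat. z = of_nat q" if "z = of_int y" "y \<ge> 0" for z :: complex and y
      using that by (metis nonneg_int_cases of_int_of_nat_eq)
    show ?nat
    proof (intro conjI allI impI)
      fix i assume i: "i < m"
      have l: "lam (cor i (Suc i)) = a i - a (Suc i)" using lam_cor_Suc[OF i] by (simp add: a_def)
      show "\<exists>q::nat. lam (cor i (Suc i)) = of_nat q"
      \<comment> \<open>For the last root \<open>a m = 0\<close> stands in for a next coefficient,
        since \<open>ks (m + 1)\<close> is unconstrained.\<close>
      proof (cases "Suc i = m")
        case True
        then show ?thesis using l am ks[OF i] nn[of "Suc i"] by (intro nat[of _ "ks (Suc i)"]) auto
      next
        case False
        then show ?thesis
          using l ks[OF i] ks[of "Suc i"] anti[of "Suc i"] i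
          by (intro nat[of _ "ks (Suc i) - ks (Suc (Suc i))"]) auto
      qed
    next
      show "\<exists>q::nat. k - lam (cor 0 m) = of_nat q"
        using ks[of 0] kk k1 assms(1,2) by (intro nat[of _ "kk - ks 1"]) (auto simp: a_def)
    qed
  qed
  then show ?thesis
    unfolding integrable_iff_nat[OF assms(1) odd] weight_formula_iff[OF odd] .
qed

end
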